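(* Let $D(x)=(d_{ij}(x))_{1\le i,j\le m}$, where the $d_{ij}:\mathbb{T}^N\to\mathbb{R}$ are continuous and, for every $x\in\mathbb{T}^N$, $D(x)$ is monotone and irreducible. Let $H_i\in C(\mathbb{T}^N\times\mathbb{R}^N)$, $i=1,\dots,m$, be coercive in $p$ uniformly in $x\in\mathbb{T}^N$. Then there is a solution $((c_1,\dots,c_1),v)\in\mathbb{R}^m\times W^{1,\infty}(\mathbb{T}^N)^m$ of $$H_i(x,Dv_i)+\sum_{j=1}^m d_{ij}(x)v_j=c_i\ \text{ in }\mathbb{T}^N,\qquad i=1,\dots,m,$$ with right-hand side vector $(c_i)_{i=1}^m=(c_1,\dots,c_1)$ (all components equal), and $(c_1,\dots,c_1)\in\ker D(x)$ for all $x\in\mathbb{T}^N$. Moreover, $(c_1,\dots,c_1)$ is unique in $\ker D$: it is the only vector $c=(c_i)_{i=1}^m$ satisfying $c\in\ker D(x)$ for all $x\in\mathbb{T}^N$ for which the system above has a solution $v\in W^{1,\infty}(\mathbb{T}^N)^m$.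
   Context: $\mathbb{T}^N$ is the $N$-dimensional flat torus. All solutions are understood in the viscosity sense. $W^{1,\infty}(\mathbb{T}^N)^m$ denotes $m$-tuples $v=(v_1,\dots,v_m)$ of Lipschitz continuous functions. A matrix $D=(d_{ij})$ is monotone if $d_{ii}\ge 0$ for all $i$, $d_{ij}\le 0$ for $i\ne j$, and $\sum_{j=1}^m d_{ij}=0$ for all $i$. It is irreducible if for every (nonempty) proper subset $\mathcal{I}\subsetneq\{1,\dots,m\}$ there exist $i\in\mathcal{I}$ and $j\notin\mathcal{I}$ with $d_{ij}\ne 0$. Coercive in $p$ uniformly in $x$ means $H_i(x,p)\to+\infty$ as $|p|\to\infty$ uniformly in $x\in\mathbb{T}^N$. *)

theory Defs
  imports "HOL-Analysis.Analysis"
begin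

text \<open>
  The flat torus is R^N / Z^N; a function on it is represented by its Z^N-periodic lift to
  \<open>real ^ 'n\<close>, with N = \<open>CARD('n)\<close>. Continuity, Lipschitz continuity and
  (local) viscosity tests are the same for a function on the torus and for its lift.
  The m components of a system are indexed by a finite type \<open>'m\<close>, with m = \<open>CARD('m)\<close>.
\<close>

definition torus_fun :: "(real ^ 'n \<Rightarrow> 'b) \<Rightarrow> bool" where
  "torus_fun f \<longleftrightarrow> (\<forall>x k. (\<forall>l. k $ l \<in> \<int>) \<longrightarrow> f (x + k) = f x)"

definition W1inf_torus :: "('m \<Rightarrow> real ^ 'n \<Rightarrow> real) set" where
  "W1inf_torus = {v. \<forall>i. torus_fun (v i) \<and> (\<exists>L. L-lipschitz_on UNIV (v i))}"

definition monotone_matrix :: "real ^ 'm ^ 'm \<Rightarrow> bool" where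
  "monotone_matrix A \<longleftrightarrow>
     (\<forall>i. 0 \<le> A $ i $ i) \<and>
     (\<forall>i j. i \<noteq> j \<longrightarrow> A $ i $ j \<le> 0) \<and>
     (\<forall>i. (\<Sum>j\<in>UNIV. A $ i $ j) = 0)"

definition irreducible_matrix :: "real ^ 'm ^ 'm \<Rightarrow> bool" where
  "irreducible_matrix A \<longleftrightarrow>
     (\<forall>I. I \<noteq> {} \<and> I \<subset> UNIV \<longrightarrow> (\<exists>i\<in>I. \<exists>j. j \<notin> I \<and> A $ i $ j \<noteq> 0))"

definition matrix_ker :: "real ^ 'm ^ 'm \<Rightarrow> (real ^ 'm) set" where
  "matrix_ker A = {c. A *v c = 0}"

text \<open>Continuous Hamiltonian on the torus times R^N (periodic in the first variable only).\<close>

definition hamiltonian :: "(real ^ 'n \<Rightarrow> real ^ 'n \<Rightarrow> real) \<Rightarrow> bool" where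
  "hamiltonian h \<longleftrightarrow> torus_fun h \<and> continuous_on UNIV (\<lambda>(x, p). h x p)"

definition coercive :: "(real ^ 'n \<Rightarrow> real ^ 'n \<Rightarrow> real) \<Rightarrow> bool" where
  "coercive h \<longleftrightarrow> (\<forall>K. \<forall>\<^sub>F p in at_infinity. \<forall>x. K \<le> h x p)"

text \<open>\<open>C1_test \<phi> G\<close>: \<open>\<phi>\<close> is a C^1 function on R^N with gradient \<open>G\<close>.\<close>

definition C1_test :: "(real ^ 'n \<Rightarrow> real) \<Rightarrow> (real ^ 'n \<Rightarrow> real ^ 'n) \<Rightarrow> bool" where
  "C1_test \<phi> G \<longleftrightarrow> (\<forall>y. GDERIV \<phi> y :> G y) \<and> continuous_on UNIV G"

definition local_max :: "(real ^ 'n \<Rightarrow> real) \<Rightarrow> real ^ 'n \<Rightarrow> bool" where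
  "local_max g x \<longleftrightarrow> (\<forall>\<^sub>F y in nhds x. g y \<le> g x)"

definition local_min :: "(real ^ 'n \<Rightarrow> real) \<Rightarrow> real ^ 'n \<Rightarrow> bool" where
  "local_min g x \<longleftrightarrow> (\<forall>\<^sub>F y in nhds x. g x \<le> g y)"

text \<open>
  Continuous viscosity sub- and supersolutions of the weakly coupled system
  \<open>H i x (D v\<^sub>i) + (\<Sum>j. d\<^sub>i\<^sub>j(x) v\<^sub>j) = c\<^sub>i\<close>, where \<open>d\<^sub>i\<^sub>j(x) = D x $ i $ j\<close>. Only the component
  carrying the derivative is tested; the coupling term uses the values of \<open>v\<close> itself.
\<close>

definition visc_subsolution ::
  "('m::finite \<Rightarrow> real ^ 'n \<Rightarrow> real ^ 'n \<Rightarrow> real) \<Rightarrow> (real ^ 'n \<Rightarrow> real ^ 'm ^ 'm) \<Rightarrow>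
   real ^ 'm \<Rightarrow> ('m \<Rightarrow> real ^ 'n \<Rightarrow> real) \<Rightarrow> bool" where
  "visc_subsolution H D c v \<longleftrightarrow>
     (\<forall>i. continuous_on UNIV (v i)) \<and>
     (\<forall>i x \<phi> G. C1_test \<phi> G \<and> local_max (\<lambda>y. v i y - \<phi> y) x \<longrightarrow>
        H i x (G x) + (\<Sum>j\<in>UNIV. D x $ i $ j * v j x) \<le> c $ i)"

definition visc_supersolution ::
  "('m::finite \<Rightarrow> real ^ 'n \<Rightarrow> real ^ 'n \<Rightarrow> real) \<Rightarrow> (real ^ 'n \<Rightarrow> real ^ 'm ^ 'm) \<Rightarrow>
   real ^ 'm \<Rightarrow> ('m \<Rightarrow> real ^ 'n \<Rightarrow> real) \<Rightarrow> bool" where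
  "visc_supersolution H D c v \<longleftrightarrow>
     (\<forall>i. continuous_on UNIV (v i)) \<and>
     (\<forall>i x \<phi> G. C1_test \<phi> G \<and> local_min (\<lambda>y. v i y - \<phi> y) x \<longrightarrow>
        c $ i \<le> H i x (G x) + (\<Sum>j\<in>UNIV. D x $ i $ j * v j x))"

definition visc_solution ::
  "('m::finite \<Rightarrow> real ^ 'n \<Rightarrow> real ^ 'n \<Rightarrow> real) \<Rightarrow> (real ^ 'n \<Rightarrow> real ^ 'm ^ 'm) \<Rightarrow>
   real ^ 'm \<Rightarrow> ('m \<Rightarrow> real ^ 'n \<Rightarrow> real) \<Rightarrow> bool" where
  "visc_solution H D c v \<longleftrightarrow> visc_subsolution H D c v \<and> visc_supersolution H D c v"

end

theory Submission
  imports Defs "HOL-Complex_Analysis.Great_Picard"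
begin

text \<open>
  The system is approximated by the discounted one, with coupling matrix \<open>D(x) + l I\<close>, \<open>l > 0\<close>.
  A subsolution \<open>w\<close> of it with \<open>l |w|\<close> bounded satisfies \<open>D(x) w(x) \<le> C\<close> at every point, because the
  Hamiltonians are bounded below; irreducibility and compactness of the torus then bound
  \<open>w\<^sub>i - w\<^sub>j\<close>, hence \<open>H\<^sub>i(x, Dw\<^sub>i)\<close>, hence by coercivity the Lipschitz constant of \<open>w\<close>, all independently
  of \<open>l\<close>. The pointwise supremum of these subsolutions is therefore Lipschitz, and Perron's argument
  shows that it is a solution, without any comparison principle. The subsolutions in Perron's class are
  not required to be periodic, so bumps can be purely local; the supremum is periodic since the class is
  translation invariant. After subtracting a constant of order \<open>1/l\<close>, the Arzela-Ascoli theorem and stability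
  let \<open>l\<close> tend to 0. Uniqueness of the constant follows by doubling the variables, maximising
  \<open>v\<^sub>i(x) - w\<^sub>i(y) - k |x - y|\<^sup>2\<close> over the index \<open>i\<close> as well: monotonicity makes the coupling term have
  the right sign at such a maximum.
\<close>

section \<open>Test functions and gradient bounds\<close>

lemma C1_test_has_derivative:
  "C1_test \<phi> G \<Longrightarrow> (\<phi> has_derivative (\<lambda>h. h \<bullet> G y)) (at y)"
  by (simp add: C1_test_def gderiv_def)

lemma C1_testI:
  assumes "\<And>y. (\<phi> has_derivative (\<lambda>h. h \<bullet> G y)) (at y)" and "continuous_on UNIV G"
  shows "C1_test \<phi> G"
  using assms by (simp add: C1_test_def gderiv_def)

lemma C1_test_continuous: "C1_test \<phi> G \<Longrightarrow> continuous_on S \<phi>"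
  by (meson C1_test_has_derivative continuous_at_imp_continuous_on has_derivative_continuous)

lemma C1_test_gradient_continuous: "C1_test \<phi> G \<Longrightarrow> continuous_on UNIV G"
  by (simp add: C1_test_def)

lemma C1_test_add:
  assumes "C1_test \<phi> G" "C1_test \<psi> K"
  shows "C1_test (\<lambda>y. \<phi> y + \<psi> y) (\<lambda>y. G y + K y)"
proof (rule C1_testI)
  show "((\<lambda>y. \<phi> y + \<psi> y) has_derivative (\<lambda>h. h \<bullet> (G y + K y))) (at y)" for y
    by (auto intro!: derivative_eq_intros C1_test_has_derivative assms simp: inner_add_right)
qed (use assms in \<open>auto intro!: continuous_intros simp: C1_test_def\<close>)

lemma C1_test_minus:
  assumes "C1_test \<phi> G"
  shows "C1_test (\<lambda>y. - \<phi> y) (\<lambda>y. - G y)"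
proof (rule C1_testI)
  show "((\<lambda>y. - \<phi> y) has_derivative (\<lambda>h. h \<bullet> - G y)) (at y)" for y
    by (auto intro!: derivative_eq_intros C1_test_has_derivative assms)
qed (use assms in \<open>auto intro!: continuous_intros simp: C1_test_def\<close>)

lemma C1_test_const: "C1_test (\<lambda>_. a) (\<lambda>_. 0)"
  by (rule C1_testI) auto

lemma C1_test_norm_square:
  fixes x :: "real ^ 'n"
  shows "C1_test (\<lambda>y. a * (norm (y - x))\<^sup>2) (\<lambda>y. (2 * a) *\<^sub>R (y - x))"
proof (rule C1_testI)
  show "((\<lambda>y. a * (norm (y - x))\<^sup>2) has_derivative (\<lambda>h. h \<bullet> (2 * a) *\<^sub>R (y - x))) (at y)" for y
    unfolding power2_norm_eq_inner
    by (auto intro!: derivative_eq_intros simp: algebra_simps inner_commute)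
qed (auto intro!: continuous_intros)

text \<open>A smooth substitute for the cone \<open>a * norm (y - x)\<close>: a positive
  \<open>e\<close> rounds off the vertex, and the cone returns as \<open>e\<close> tends to
  0.\<close>

lemma C1_test_sqrt:
  fixes x :: "real ^ 'n"
  assumes "0 < e"
  shows "C1_test (\<lambda>y. a * sqrt (e\<^sup>2 + (norm (y - x))\<^sup>2))
    (\<lambda>y. (a / sqrt (e\<^sup>2 + (norm (y - x))\<^sup>2)) *\<^sub>R (y - x))"
proof (rule C1_testI)
  have pos: "0 < e\<^sup>2 + (norm (y - x))\<^sup>2" for y
    using assms by (simp add: add_pos_nonneg)
  show "((\<lambda>y. a * sqrt (e\<^sup>2 + (norm (y - x))\<^sup>2)) has_derivative
      (\<lambda>h. h \<bullet> (a / sqrt (e\<^sup>2 + (norm (y - x))\<^sup>2)) *\<^sub>R (y - x))) (at y)" for y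
    using pos[of y] unfolding power2_norm_eq_inner
    by (auto intro!: derivative_eq_intros simp: algebra_simps inner_commute divide_simps)
  show "continuous_on UNIV (\<lambda>y. (a / sqrt (e\<^sup>2 + (norm (y - x))\<^sup>2)) *\<^sub>R (y - x))"
    using pos by (auto intro!: continuous_intros simp: less_imp_neq[symmetric])
qed

text \<open>Fermat's rule for the difference. It identifies the gradient of a test function touching
  a function that is itself smooth, here a Perron bump or a constant.\<close>

lemma C1_test_local_max_gradient:
  assumes \<phi>: "C1_test \<phi> G" and \<psi>: "C1_test \<psi> K" and max: "local_max (\<lambda>y. \<phi> y - \<psi> y) x"
  shows "G x = K x"
proof -
  from max obtain S where S: "open S" "x \<in> S" "\<forall>y\<in>S. \<phi> y - \<psi> y \<le> \<phi> x - \<psi> x"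
    unfolding local_max_def eventually_nhds by blast
  have "((\<lambda>y. \<phi> y - \<psi> y) has_derivative (\<lambda>h. h \<bullet> G x - h \<bullet> K x)) (at x)"
    by (intro has_derivative_diff C1_test_has_derivative \<phi> \<psi>)
  then have "(\<lambda>h. h \<bullet> G x - h \<bullet> K x) = (\<lambda>h. 0)"
    using differential_zero_maxmin[OF S(2,1)] S(3) by blast
  then have "(G x - K x) \<bullet> (G x - K x) = 0"
    by (metis inner_diff_right)
  then show ?thesis by simp
qed

lemma local_max_cong:
  assumes "local_max f x" "\<forall>\<^sub>F y in nhds x. g y - g x \<le> f y - f x"
  shows "local_max g x"
  using assms unfolding local_max_def by eventually_elim linarith

text \<open>No value outside the ball of radius \<open>\<rho>\<close> about \<open>x\<close> exceeds
  \<open>g x\<close>, so the maximum over this compact ball is global.\<close>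

lemma attains_max_of_decay:
  fixes g :: "'a::heine_borel \<Rightarrow> real"
  assumes "continuous_on UNIV g" and "\<And>z. \<rho> < dist x z \<Longrightarrow> g z \<le> g x"
  shows "\<exists>y. \<forall>z. g z \<le> g y"
proof -
  \<comment> \<open>Clipping the radius at 0 keeps the ball nonempty when \<open>\<rho>\<close> is
    negative.\<close>
  have "compact (cball x (max 0 \<rho>))" "cball x (max 0 \<rho>) \<noteq> {}" by auto
  then obtain y where y: "y \<in> cball x (max 0 \<rho>)" "\<forall>z\<in>cball x (max 0 \<rho>). g z \<le> g y"
    using continuous_attains_sup continuous_on_subset[OF assms(1)] by (metis subset_UNIV)
  have "g z \<le> g y" for z
  proof (cases "dist x z \<le> \<rho>")
    case False
    have "x \<in> cball x (max 0 \<rho>)" by simp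
    then show ?thesis using False y assms(2)[of z] by fastforce
  qed (use y in auto)
  then show ?thesis by blast
qed

text \<open>The gradient of the smoothed cone \<open>R' sqrt (e^2 + |y - x|^2)\<close> exceeds \<open>R\<close> in norm outside a ball
  whose radius is proportional to \<open>e\<close>, so the maximum of \<open>u\<close> minus this cone lies near \<open>x\<close>.\<close>

lemma lipschitz_of_gradient_bound:
  fixes u :: "real ^ 'n \<Rightarrow> real"
  assumes cont: "continuous_on UNIV u" and bnd: "\<And>x. \<bar>u x\<bar> \<le> B" and "0 \<le> R"
    and grad: "\<And>x \<phi> G. C1_test \<phi> G \<Longrightarrow> local_max (\<lambda>y. u y - \<phi> y) x \<Longrightarrow> norm (G x) \<le> R"
  shows "R-lipschitz_on UNIV u"
proof -
  \<comment> \<open>A slope strictly above \<open>R\<close> makes the constant \<open>C\<close>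
    below finite; the excess \<open>d\<close> is removed at the end.\<close>
  have key: "u z \<le> u x + (R + d) * norm (z - x)" if "0 < d" for x z d
  proof -
    define a where "a = R + d"
    have a: "0 < a" "R < a" using \<open>0 \<le> R\<close> that by (auto simp: a_def)
    \<comment> \<open>For \<open>t = norm (y - x)\<close>, solving
      \<open>a * t \<le> R * sqrt (e^2 + t^2)\<close> for \<open>t\<close> gives
      \<open>t \<le> C * e\<close>.\<close>
    define C where "C = R / sqrt (a\<^sup>2 - R\<^sup>2)"
    have aR: "0 < a\<^sup>2 - R\<^sup>2" using a \<open>0 \<le> R\<close> by (simp add: power_strict_mono)
    have C0: "0 \<le> C" using \<open>0 \<le> R\<close> aR by (simp add: C_def)
    define e where "e n = inverse (real (Suc n))" for n
    have e0: "0 < e n" for n by (simp add: e_def)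
    define s where "s n y = sqrt ((e n)\<^sup>2 + (norm (y - x))\<^sup>2)" for n y
    have s_ge: "norm (y - x) \<le> s n y" for n y
      by (simp add: s_def real_le_rsqrt)
    have s_pos: "0 < s n y" for n y
      using e0[of n] by (simp add: s_def add_pos_nonneg)
    have s_x: "s n x = e n" for n using e0[of n] by (simp add: s_def)
    have "\<exists>y. norm (y - x) \<le> C * e n \<and> u z - a * s n z \<le> u y" for n
    proof -
      have "\<exists>y. \<forall>z. u z - a * s n z \<le> u y - a * s n y"
      proof (rule attains_max_of_decay)
        show "continuous_on UNIV (\<lambda>y. u y - a * s n y)"
          unfolding s_def by (intro continuous_intros cont)
        \<comment> \<open>Beyond this radius the smoothed cone has risen by more than
          \<open>2 * B\<close> above its vertex value \<open>a * e n\<close>, and \<open>u\<close>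
          cannot rise by more than \<open>2 * B\<close>.\<close>
        fix z assume "(2 * B + a * e n) / a < dist x z"
        then have "2 * B + a * e n < a * norm (z - x)"
          using a by (simp add: field_simps dist_norm norm_minus_commute)
        also have "\<dots> \<le> a * s n z" using s_ge a by (simp add: mult_left_mono)
        finally show "u z - a * s n z \<le> u x - a * s n x"
          using bnd[of x] bnd[of z] by (simp add: s_x)
      qed
      then obtain y where y: "\<And>z. u z - a * s n z \<le> u y - a * s n y" by blast
      have "norm ((a / s n y) *\<^sub>R (y - x)) \<le> R"
        using C1_test_sqrt[OF e0[of n], of a x] y unfolding s_def
        by (intro grad[where \<phi> = "\<lambda>y. a * s n y", unfolded s_def]) (auto simp: local_max_def)
      then have "a / s n y * norm (y - x) \<le> R"
        using s_pos[of n y] a by simp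
      then have "a * norm (y - x) \<le> R * s n y"
        using s_pos[of n y] a by (simp add: field_simps)
      then have "(a * norm (y - x))\<^sup>2 \<le> (R * s n y)\<^sup>2"
        using a by (intro power_mono) auto
      then have "a\<^sup>2 * (norm (y - x))\<^sup>2 \<le> R\<^sup>2 * ((e n)\<^sup>2 + (norm (y - x))\<^sup>2)"
        by (simp add: power_mult_distrib s_def)
      then have "(norm (y - x))\<^sup>2 \<le> R\<^sup>2 * (e n)\<^sup>2 / (a\<^sup>2 - R\<^sup>2)"
        using aR by (simp add: field_simps)
      also have "\<dots> = (C * e n)\<^sup>2"
        using aR by (simp add: C_def power_divide power_mult_distrib)
      finally have "norm (y - x) \<le> C * e n"
        by (rule power2_le_imp_le) (use C0 e0[of n] in simp)
      moreover have "u z - a * s n z \<le> u y"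
        using y[of z] a s_pos[of n y] by (smt (verit) mult_pos_pos)
      ultimately show ?thesis by blast
    qed
    then obtain y where y: "\<And>n. norm (y n - x) \<le> C * e n" "\<And>n. u z - a * s n z \<le> u (y n)"
      by metis
    have e_lim: "e \<longlonglongrightarrow> 0" unfolding e_def by (rule LIMSEQ_inverse_real_of_nat)
    have "(\<lambda>n. C * e n) \<longlonglongrightarrow> 0" using tendsto_mult_right_zero[OF e_lim] by simp
    then have "(\<lambda>n. y n - x) \<longlonglongrightarrow> 0"
      by (rule Lim_null_comparison[rotated]) (use y in auto)
    then have "y \<longlonglongrightarrow> x" by (simp add: LIM_zero_iff)
    then have "(\<lambda>n. u (y n)) \<longlonglongrightarrow> u x"
      by (intro continuous_on_tendsto_compose[OF cont]) auto
    moreover have "(\<lambda>n. u z - a * s n z) \<longlonglongrightarrow> u z - a * sqrt (0\<^sup>2 + (norm (z - x))\<^sup>2)"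
      unfolding s_def by (intro tendsto_intros e_lim)
    ultimately have "u z - a * sqrt (0\<^sup>2 + (norm (z - x))\<^sup>2) \<le> u x"
      using y(2) by (intro LIMSEQ_le) auto
    then show ?thesis by (simp add: a_def)
  qed
  have le: "u z \<le> u x + R * norm (z - x)" for x z
  proof (rule field_le_epsilon)
    fix e :: real assume "0 < e"
    \<comment> \<open>The summand 1 avoids a zero denominator at \<open>z = x\<close>, and still
      \<open>d * norm (z - x) \<le> e\<close>.\<close>
    define d where "d = e / (1 + norm (z - x))"
    have p: "0 < 1 + norm (z - x)" by (simp add: add_pos_nonneg)
    have "0 < d" using \<open>0 < e\<close> p by (simp add: d_def)
    moreover have "d * norm (z - x) \<le> e"
      using p \<open>0 < e\<close> by (simp add: d_def field_simps)
    ultimately show "u z \<le> u x + R * norm (z - x) + e"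
      using key[of d z x] by (simp add: algebra_simps)
  qed
  show ?thesis
  proof (rule lipschitz_onI)
    show "dist (u x) (u y) \<le> R * dist x y" for x y
      using le[of x y] le[of y x] by (simp add: dist_norm norm_minus_commute abs_le_iff)
  qed fact
qed

section \<open>Periodic functions and irreducible matrices\<close>

lemma torus_funD: "torus_fun f \<Longrightarrow> \<forall>l. k $ l \<in> \<int> \<Longrightarrow> f (x + k) = f x"
  by (simp add: torus_fun_def)

text \<open>Subtracting integer parts moves any point into the closed unit cube. This compact set
  plays the part of the torus in all compactness arguments.\<close>

lemma torus_representative:
  fixes x :: "real ^ 'n"
  obtains k where "\<forall>l. k $ l \<in> \<int>" "x + k \<in> cbox 0 1"
proof
  let ?k = "\<chi> l. - real_of_int \<lfloor>x $ l\<rfloor>"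
  show "\<forall>l. ?k $ l \<in> \<int>" by simp
  show "x + ?k \<in> cbox 0 1"
    unfolding mem_box_cart using real_of_int_floor_add_one_ge by (auto simp: algebra_simps)
qed

lemma torus_bounded:
  fixes f :: "real ^ 'n \<Rightarrow> real"
  assumes "torus_fun f" "continuous_on UNIV f"
  obtains B where "\<And>x. \<bar>f x\<bar> \<le> B"
proof -
  have "compact (f ` cbox 0 1)"
    using assms(2) by (intro compact_continuous_image compact_cbox) (rule continuous_on_subset, auto)
  then obtain B where B: "\<And>x. x \<in> cbox 0 1 \<Longrightarrow> \<bar>f x\<bar> \<le> B"
    using compact_imp_bounded by (fastforce simp: bounded_iff)
  have "\<bar>f x\<bar> \<le> B" for x
  proof -
    obtain k where "\<forall>l. k $ l \<in> \<int>" "x + k \<in> cbox 0 1" by (rule torus_representative)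
    then show ?thesis using B torus_funD[OF assms(1)] by metis
  qed
  then show thesis by (rule that)
qed

text \<open>Turns one bound per component into a common one: since \<open>P i\<close> is stable
  under enlarging the bound, the sum of the absolute values of all bounds serves every
  index.\<close>

lemma uniform_bound_finite:
  fixes P :: "'m::finite \<Rightarrow> real \<Rightarrow> bool"
  assumes "\<And>i. \<exists>B. P i B" and "\<And>i B B'. P i B \<Longrightarrow> B \<le> B' \<Longrightarrow> P i B'"
  obtains B where "0 \<le> B" "\<And>i. P i B"
proof -
  obtain b where b: "\<And>i. P i (b i)" using assms(1) by metis
  have "b i \<le> (\<Sum>j\<in>UNIV. \<bar>b j\<bar>)" for i
    by (rule order_trans[OF abs_ge_self]) (rule member_le_sum, auto)
  then show thesis using assms(2)[OF b] by (intro that[of "\<Sum>j\<in>UNIV. \<bar>b j\<bar>"]) (auto intro: sum_nonneg)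
qed

lemma hamiltonian_bounded:
  fixes h :: "real ^ 'n \<Rightarrow> real ^ 'n \<Rightarrow> real"
  assumes "hamiltonian h"
  obtains B where "\<And>x p. norm p \<le> r \<Longrightarrow> \<bar>h x p\<bar> \<le> B"
proof -
  have "compact ((\<lambda>(x, p). h x p) ` (cbox 0 1 \<times> cball 0 r))"
    using assms unfolding hamiltonian_def
    by (intro compact_continuous_image compact_Times compact_cbox compact_cball)
      (rule continuous_on_subset, auto)
  then obtain B where B: "\<And>x p. x \<in> cbox 0 1 \<Longrightarrow> norm p \<le> r \<Longrightarrow> \<bar>h x p\<bar> \<le> B"
    using compact_imp_bounded by (fastforce simp: bounded_iff)
  have "\<bar>h x p\<bar> \<le> B" if "norm p \<le> r" for x p
  proof -
    obtain k where "\<forall>l. k $ l \<in> \<int>" "x + k \<in> cbox 0 1" by (rule torus_representative)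
    then show ?thesis using B that torus_funD assms unfolding hamiltonian_def by metis
  qed
  then show thesis by (rule that)
qed

lemma coercive_radius:
  assumes "coercive h"
  obtains R where "\<And>x p. h x p \<le> K \<Longrightarrow> norm p \<le> R"
proof -
  obtain R where "\<And>x p. norm p \<ge> R \<Longrightarrow> K + 1 \<le> h x p"
    using assms unfolding coercive_def eventually_at_infinity by meson
  then show thesis by (intro that[of R]) (smt (verit))
qed

text \<open>By coercivity \<open>h\<close> is positive for \<open>p\<close> outside a large ball;
  over that ball it is bounded by compactness and periodicity.\<close>

lemma hamiltonian_bounded_below:
  assumes "hamiltonian h" "coercive h"
  obtains K where "\<And>x p. - K \<le> h x p"
proof -
  obtain R where R: "\<And>x p. h x p \<le> 0 \<Longrightarrow> norm p \<le> R" 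
    using coercive_radius[OF assms(2), of 0] by blast
  obtain B where B: "\<And>x p. norm p \<le> R \<Longrightarrow> \<bar>h x p\<bar> \<le> B" 
    using hamiltonian_bounded[OF assms(1), of R] by blast
  have "- \<bar>B\<bar> \<le> h x p" for x p using R[of x p] B[of p x] by linarith
  then show thesis by (rule that)
qed

text \<open>The row sums vanish, so the coupling sees only differences of components. With
  \<open>a\<close> an extreme value of \<open>z\<close>, all factors \<open>z j - a\<close> have the
  same sign.\<close>

lemma monotone_sum_diff:
  assumes "monotone_matrix A"
  shows "(\<Sum>j\<in>UNIV. A $ i $ j * (z j - a)) = (\<Sum>j\<in>UNIV. A $ i $ j * z j)"
  using assms by (simp add: monotone_matrix_def right_diff_distrib sum_subtractf flip: sum_distrib_right)

text \<open>A discrete maximum principle. In a row \<open>i\<close> where \<open>z\<close> attains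
  its maximum \<open>b\<close>, every product of \<open>A $ i $ k\<close> with
  \<open>z k - b\<close> is nonnegative; if the maximum is not attained everywhere, irreducibility
  yields such a row with a strictly positive product.\<close>

lemma irreducible_subharmonic_constant:
  fixes A :: "real ^ 'm ^ 'm"
  assumes mon: "monotone_matrix A" and irr: "irreducible_matrix A"
    and le: "\<And>i. (\<Sum>j\<in>UNIV. A $ i $ j * z j) \<le> 0"
  shows "z i = z j"
proof -
  define b where "b = Max (range z)"
  have z_le: "z k \<le> b" for k by (simp add: b_def)
  define I where "I = {k. z k = b}"
  have "b \<in> range z" unfolding b_def by (intro Max_in) auto
  then have "I \<noteq> {}" by (auto simp: I_def)
  have "I = UNIV"
  proof (rule ccontr)
    assume "I \<noteq> UNIV"
    then obtain i j where ij: "i \<in> I" "j \<notin> I" "A $ i $ j \<noteq> 0"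
      using irr \<open>I \<noteq> {}\<close> unfolding irreducible_matrix_def by (metis psubsetI subset_UNIV)
    have neg: "A $ i $ k \<le> 0" if "k \<noteq> i" for k
      using mon that by (simp add: monotone_matrix_def)
    have "0 < (\<Sum>k\<in>UNIV. A $ i $ k * (z k - b))"
    proof (rule sum_pos2[of UNIV j])
      have "j \<noteq> i" using ij by blast
      moreover have "z j < b" using ij(2) z_le[of j] by (simp add: I_def)
      ultimately show "0 < A $ i $ j * (z j - b)"
        using neg[of j] ij(3) by (intro mult_neg_neg) auto
      show "0 \<le> A $ i $ k * (z k - b)" for k
        using neg[of k] z_le[of k] ij(1) by (cases "k = i") (auto simp: I_def intro: mult_nonpos_nonpos)
    qed auto
    then show False using le[of i] monotone_sum_diff[OF mon] by (metis not_less)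
  qed
  then have "z k = b" for k by (auto simp: I_def)
  then show ?thesis by simp
qed

text \<open>The maximum principle makes kernel vectors constant, and zero row sums give the
  converse. The kernel condition thus reduces the vector \<open>c\<close> to one real
  number.\<close>

lemma matrix_ker_monotone_irreducible:
  assumes "monotone_matrix A" "irreducible_matrix A"
  shows "matrix_ker A = range (\<lambda>a. \<chi> i. a)"
proof -
  have "c $ i = c $ j" if "A *v c = 0" for c i j
    using that by (intro irreducible_subharmonic_constant[OF assms]) (simp add: vec_eq_iff matrix_vector_mult_def)
  then have "c \<in> range (\<lambda>a. \<chi> i. a)" if "A *v c = 0" for c
    using that by (intro image_eqI[of _ _ "c $ undefined"]) (auto simp: vec_eq_iff)
  moreover have "A *v (\<chi> i. a) = 0" for a
    using assms(1) by (simp add: vec_eq_iff matrix_vector_mult_def monotone_matrix_def flip: sum_distrib_right)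
  ultimately show ?thesis unfolding matrix_ker_def by auto
qed

text \<open>A quantitative form of the maximum principle, by homogeneity and compactness: after
  normalising \<open>z\<close> to have minimum 0 and maximum 1, the positive parts of the row sums
  have total at least some \<open>\<delta> > 0\<close>, uniformly in \<open>x\<close>. Scaling back
  gives the constant \<open>m / \<delta>\<close>, where \<open>m\<close> is the number of
  components.\<close>

lemma irreducible_oscillation_bound:
  fixes D :: "real ^ 'n \<Rightarrow> real ^ 'm ^ 'm"
  assumes per: "\<And>i j. torus_fun (\<lambda>x. D x $ i $ j)"
    and cont: "\<And>i j. continuous_on UNIV (\<lambda>x. D x $ i $ j)"
    and mon: "\<And>x. monotone_matrix (D x)" and irr: "\<And>x. irreducible_matrix (D x)"
  obtains K where "0 \<le> K"
    "\<And>x z C i j. 0 \<le> C \<Longrightarrow> (\<And>i. (\<Sum>j\<in>UNIV. D x $ i $ j * z j) \<le> C) \<Longrightarrow> z i - z j \<le> K * C"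
proof -
  \<comment> \<open>The normalised vectors: entries in [0,1] with both end values attained.\<close>
  define Z :: "(real ^ 'm) set" where
    "Z = cbox 0 1 \<inter> (\<Union>i. {z. z $ i = 0}) \<inter> (\<Union>j. {z. z $ j = 1})"
  \<comment> \<open>A zero of \<open>f\<close> is a point where all row sums are nonpositive; the
    maximum principle then makes \<open>z\<close> constant, which is impossible in
    \<open>Z\<close>.\<close>
  define f where "f = (\<lambda>(x, z :: real ^ 'm). \<Sum>i\<in>UNIV. max 0 (\<Sum>j\<in>UNIV. D x $ i $ j * z $ j))"
  have "closed {z :: real ^ 'm. z $ i = a}" for i a
    by (intro closed_Collect_eq continuous_intros)
  then have "compact Z"
    unfolding Z_def by (intro compact_Int_closed compact_cbox closed_UN finite) auto
  then have comp: "compact (cbox 0 1 \<times> Z :: ((real ^ 'n) \<times> (real ^ 'm)) set)"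
    by (intro compact_Times compact_cbox)
  have contD: "continuous_on S (\<lambda>p :: (real ^ 'n) \<times> (real ^ 'm). D (fst p) $ i $ j)" for S i j
    by (rule continuous_on_compose2[OF cont[of i j]]) (auto intro: continuous_intros)
  have contf: "continuous_on S f" for S
    unfolding f_def case_prod_unfold by (intro continuous_intros contD)
  have f_pos: "0 < f (x, z)" if "z \<in> Z" for x z
  proof (rule ccontr)
    assume "\<not> 0 < f (x, z)"
    then have "(\<Sum>i\<in>UNIV. max 0 (\<Sum>j\<in>UNIV. D x $ i $ j * z $ j)) \<le> 0" by (simp add: f_def)
    then have "(\<Sum>i\<in>UNIV. max 0 (\<Sum>j\<in>UNIV. D x $ i $ j * z $ j)) = 0"
      by (intro antisym sum_nonneg) auto
    then have "max 0 (\<Sum>j\<in>UNIV. D x $ i $ j * z $ j) = 0" for i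
      by (simp add: sum_nonneg_eq_0_iff)
    then have "(\<Sum>j\<in>UNIV. D x $ i $ j * z $ j) \<le> 0" for i
      by (metis max.cobounded2)
    then have "z $ i = z $ j" for i j
      by (rule irreducible_subharmonic_constant[OF mon irr])
    then show False using that by (auto simp: Z_def) (metis zero_neq_one)
  qed
  obtain \<delta> where \<delta>: "0 < \<delta>" "\<And>x z. x \<in> cbox 0 1 \<Longrightarrow> z \<in> Z \<Longrightarrow> \<delta> \<le> f (x, z)"
  \<comment> \<open>With a single component \<open>Z\<close> is empty, since one entry cannot be
    both 0 and 1; any positive \<open>\<delta>\<close> will do then.\<close>
  proof (cases "(cbox 0 1 \<times> Z :: ((real ^ 'n) \<times> (real ^ 'm)) set) = {}")
    case True
    then show thesis by (intro that[of 1]) auto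
  next
    case False
    then obtain p where "p \<in> cbox 0 1 \<times> Z" "\<forall>q\<in>cbox 0 1 \<times> Z. f p \<le> f q"
      using continuous_attains_inf[OF comp _ contf] by blast
    then show thesis using f_pos by (intro that[of "f p"]) auto
  qed
  show thesis
  proof
    show "0 \<le> real CARD('m) / \<delta>" using \<delta>(1) by simp
    fix x C i j and z :: "'m \<Rightarrow> real"
    assume C: "0 \<le> C" and le: "\<And>i. (\<Sum>j\<in>UNIV. D x $ i $ j * z j) \<le> C"
    define a where "a = Min (range z)"
    define b where "b = Max (range z)"
    have ab: "a \<le> z k" "z k \<le> b" for k by (simp_all add: a_def b_def)
    have "b \<in> range z" unfolding b_def by (intro Max_in) auto
    moreover have "a \<in> range z" unfolding a_def by (intro Min_in) auto
    ultimately obtain ia ib where iab: "a = z ia" "b = z ib" by blast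
    have "b - a \<le> real CARD('m) / \<delta> * C"
    proof (cases "a < b")
      case False
      then show ?thesis using C \<delta>(1) by (smt (verit) divide_nonneg_pos mult_nonneg_nonneg of_nat_0_le_iff)
    next
      case True
      define \<zeta> :: "real ^ 'm" where "\<zeta> = (\<chi> k. (z k - a) / (b - a))"
      have "\<zeta> $ ia = 0" "\<zeta> $ ib = 1" using True by (simp_all add: \<zeta>_def iab)
      moreover have "\<zeta> \<in> cbox 0 1" using True ab by (auto simp: \<zeta>_def mem_box_cart)
      ultimately have "\<zeta> \<in> Z" by (auto simp: Z_def)
      obtain k where k: "\<forall>l. k $ l \<in> \<int>" "x + k \<in> cbox 0 1" by (rule torus_representative)
      have "max 0 (\<Sum>j\<in>UNIV. D (x + k) $ i $ j * \<zeta> $ j) \<le> C / (b - a)" for i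
      proof -
        have "(\<Sum>j\<in>UNIV. D (x + k) $ i $ j * \<zeta> $ j) = (\<Sum>j\<in>UNIV. D x $ i $ j * (z j - a)) / (b - a)"
          using torus_funD[OF per k(1)] by (simp add: \<zeta>_def sum_divide_distrib)
        also have "\<dots> = (\<Sum>j\<in>UNIV. D x $ i $ j * z j) / (b - a)"
          by (simp add: monotone_sum_diff[OF mon])
        also have "\<dots> \<le> C / (b - a)" using True le[of i] by (simp add: divide_right_mono)
        finally show ?thesis using C True by simp
      qed
      then have "f (x + k, \<zeta>) \<le> (\<Sum>i\<in>(UNIV :: 'm set). C / (b - a))"
        unfolding f_def prod.case by (intro sum_mono)
      then have "\<delta> \<le> real CARD('m) * C / (b - a)" using \<delta>(2)[OF k(2) \<open>\<zeta> \<in> Z\<close>] by simp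
      then show ?thesis using True \<delta>(1) by (simp add: field_simps)
    qed
    then show "z i - z j \<le> real CARD('m) / \<delta> * C" using ab[of i] ab[of j] by linarith
  qed
qed

section \<open>Stability of viscosity solutions\<close>

lemma tendsto_compose_UNIV:
  assumes "continuous_on UNIV f" "(y \<longlongrightarrow> x) F"
  shows "((\<lambda>n. f (y n)) \<longlongrightarrow> f x) F"
  using assms by (intro continuous_on_tendsto_compose[OF assms(1)]) auto

text \<open>Subtracting \<open>|z - x|\<^sup>2\<close> makes the maximum at \<open>x\<close> strict, so maximum points of the perturbed
  functions must converge to \<open>x\<close>.\<close>

lemma touching_points_sequence:
  fixes v :: "real ^ 'n \<Rightarrow> real"
  assumes v: "continuous_on UNIV v" and w: "\<And>n. continuous_on UNIV (w n)" and \<phi>: "continuous_on UNIV \<phi>"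
    and e: "e \<longlonglongrightarrow> 0" and up: "\<And>n y. w n y \<le> v y + e n" and lo: "\<And>n. v x - e n \<le> w n x"
    and max: "local_max (\<lambda>y. v y - \<phi> y) x"
  obtains y where "y \<longlonglongrightarrow> x" "(\<lambda>n. w n (y n)) \<longlonglongrightarrow> v x"
    "\<forall>\<^sub>F n in sequentially. local_max (\<lambda>z. w n z - (\<phi> z + 1 * (norm (z - x))\<^sup>2)) (y n)"
proof -
  obtain d where d: "0 < d" "\<And>y. dist y x < d \<Longrightarrow> v y - \<phi> y \<le> v x - \<phi> x"
    using max unfolding local_max_def eventually_nhds_metric by blast
  define r where "r = d / 2"
  have r: "0 < r" "\<And>y. y \<in> cball x r \<Longrightarrow> v y - \<phi> y \<le> v x - \<phi> x"
    using d by (auto simp: r_def dist_commute)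
  define g where "g n z = w n z - (\<phi> z + 1 * (norm (z - x))\<^sup>2)" for n z
  have "\<exists>y\<in>cball x r. \<forall>z\<in>cball x r. g n z \<le> g n y" for n
  proof (rule continuous_attains_sup)
    show "continuous_on (cball x r) (g n)"
      unfolding g_def by (intro continuous_intros continuous_on_subset[OF w] continuous_on_subset[OF \<phi>]) auto
  qed (use r in auto)
  then obtain y where y: "\<And>n. y n \<in> cball x r" "\<And>n z. z \<in> cball x r \<Longrightarrow> g n z \<le> g n (y n)"
    by metis
  \<comment> \<open>Compare \<open>g n\<close> at \<open>x\<close> and at its maximum point
    \<open>y n\<close>, then use \<open>lo\<close> at \<open>x\<close> and the maximality of
    \<open>v - \<phi>\<close> at \<open>x\<close>.\<close>
  have key: "v (y n) - e n + (norm (y n - x))\<^sup>2 \<le> w n (y n)" for n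
    using y(2)[of x n] r lo[of n] r(2)[OF y(1)[of n]] by (simp add: g_def)
  have "(norm (y n - x))\<^sup>2 \<le> 2 * e n" for n
    using key[of n] up[of n "y n"] by linarith
  then have dist_le: "norm (y n - x) \<le> sqrt (2 * e n)" for n
    by (simp add: real_le_rsqrt)
  have "(\<lambda>n. sqrt (2 * e n)) \<longlonglongrightarrow> 0"
    using tendsto_real_sqrt[OF tendsto_mult_right_zero[OF e, of 2]] by simp
  then have "(\<lambda>n. y n - x) \<longlonglongrightarrow> 0"
    by (rule Lim_null_comparison[rotated]) (simp add: dist_le)
  then have y_lim: "y \<longlonglongrightarrow> x" by (rule LIM_zero_cancel)
  have v_lim: "(\<lambda>n. v (y n)) \<longlonglongrightarrow> v x" by (rule tendsto_compose_UNIV[OF v y_lim])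
  have "(\<lambda>n. w n (y n)) \<longlonglongrightarrow> v x"
  proof (rule tendsto_sandwich)
    show "\<forall>\<^sub>F n in sequentially. v (y n) - e n \<le> w n (y n)"
      using key by (intro always_eventually allI) (smt (verit) zero_le_power2)
    show "\<forall>\<^sub>F n in sequentially. w n (y n) \<le> v (y n) + e n" using up by simp
  qed (use tendsto_diff[OF v_lim e] tendsto_add[OF v_lim e] in auto)
  moreover have "\<forall>\<^sub>F n in sequentially. local_max (g n) (y n)"
  proof -
    have "\<forall>\<^sub>F n in sequentially. y n \<in> ball x r"
      using y_lim r(1) by (intro topological_tendstoD) auto
    then show ?thesis
    proof eventually_elim
      case (elim n)
      then have "\<forall>\<^sub>F z in nhds (y n). z \<in> ball x r" by (intro eventually_nhds_in_open) auto
      then show ?case unfolding local_max_def by eventually_elim (use y(2) in auto)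
    qed
  qed
  ultimately show thesis using y_lim that unfolding g_def by blast
qed

text \<open>Since the off-diagonal entries are nonpositive, only component \<open>i\<close> has to be approximated from below.
  This covers both a supremum of subsolutions and a uniform limit.\<close>

lemma relaxed_limit_subsolution:
  fixes H :: "'m::finite \<Rightarrow> real ^ 'n \<Rightarrow> real ^ 'n \<Rightarrow> real"
  assumes H: "continuous_on UNIV (\<lambda>(x, p). H i x p)"
    and D: "\<And>j. continuous_on UNIV (\<lambda>x. D x $ i $ j)"
    and sub: "\<And>n. visc_subsolution H (E n) (b n) (w n)"
    and off: "\<And>n y j. j \<noteq> i \<Longrightarrow> E n y $ i $ j \<le> 0"
    and E: "\<And>n y j. \<bar>E n y $ i $ j - D y $ i $ j\<bar> \<le> e n"
    and b: "(\<lambda>n. b n $ i) \<longlonglongrightarrow> c $ i" and e: "e \<longlonglongrightarrow> 0"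
    and v: "\<And>j. continuous_on UNIV (v j)"
    and up: "\<And>n j y. w n j y \<le> v j y + e n" and lo: "\<And>n. v i x - e n \<le> w n i x"
    and \<phi>: "C1_test \<phi> G" and max: "local_max (\<lambda>y. v i y - \<phi> y) x"
  shows "H i x (G x) + (\<Sum>j\<in>UNIV. D x $ i $ j * v j x) \<le> c $ i"
proof -
  obtain y where y: "y \<longlonglongrightarrow> x" "(\<lambda>n. w n i (y n)) \<longlonglongrightarrow> v i x"
    "\<forall>\<^sub>F n in sequentially. local_max (\<lambda>z. w n i z - (\<phi> z + 1 * (norm (z - x))\<^sup>2)) (y n)"
    using sub by (auto simp: visc_subsolution_def
        intro: touching_points_sequence[OF v[of i] _ C1_test_continuous[OF \<phi>] e up lo max])
  \<comment> \<open>Component \<open>i\<close> is known to converge along \<open>y n\<close>, while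
    the others are known only from above. Replacing those by the upper bounds
    \<open>v j + e n\<close> can only decrease the coupling sum, because their coefficients are
    nonpositive, and the replaced values do converge.\<close>
  define z where "z n j = (if j = i then w n i (y n) else v j (y n) + e n)" for n j
  have z: "(\<lambda>n. z n j) \<longlonglongrightarrow> v j x" for j
    using y(2) tendsto_add[OF tendsto_compose_UNIV[OF v y(1)] e, of j] by (cases "j = i") (simp_all add: z_def)
  have E_lim: "(\<lambda>n. E n (y n) $ i $ j) \<longlonglongrightarrow> D x $ i $ j" for j
  proof -
    have "(\<lambda>n. E n (y n) $ i $ j - D (y n) $ i $ j) \<longlonglongrightarrow> 0"
      by (rule Lim_null_comparison[OF _ e]) (simp add: E)
    from tendsto_add[OF this tendsto_compose_UNIV[OF D y(1), of j]] show ?thesis by simp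
  qed
  have "(\<lambda>n. y n - x) \<longlonglongrightarrow> 0" using y(1) by (simp add: LIM_zero_iff)
  then have "(\<lambda>n. G (y n) + (2 * 1) *\<^sub>R (y n - x)) \<longlonglongrightarrow> G x + (2 * 1) *\<^sub>R 0"
    by (intro tendsto_intros tendsto_compose_UNIV[OF C1_test_gradient_continuous[OF \<phi>] y(1)])
  then have "(\<lambda>n. (y n, G (y n) + (2 * 1) *\<^sub>R (y n - x))) \<longlonglongrightarrow> (x, G x)"
    using y(1) by (intro tendsto_Pair) auto
  from tendsto_compose_UNIV[OF H this]
  have "(\<lambda>n. H i (y n) (G (y n) + (2 * 1) *\<^sub>R (y n - x))) \<longlonglongrightarrow> H i x (G x)" by simp
  then have "(\<lambda>n. H i (y n) (G (y n) + (2 * 1) *\<^sub>R (y n - x)) + (\<Sum>j\<in>UNIV. E n (y n) $ i $ j * z n j))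
      \<longlonglongrightarrow> H i x (G x) + (\<Sum>j\<in>UNIV. D x $ i $ j * v j x)"
    by (intro tendsto_intros E_lim z)
  moreover have "\<forall>\<^sub>F n in sequentially.
      H i (y n) (G (y n) + (2 * 1) *\<^sub>R (y n - x)) + (\<Sum>j\<in>UNIV. E n (y n) $ i $ j * z n j) \<le> b n $ i"
    using y(3)
  proof eventually_elim
    case (elim n)
    have "(\<Sum>j\<in>UNIV. E n (y n) $ i $ j * z n j) \<le> (\<Sum>j\<in>UNIV. E n (y n) $ i $ j * w n j (y n))"
      using off up by (intro sum_mono) (auto simp: z_def intro: mult_left_mono_neg)
    moreover have "H i (y n) (G (y n) + (2 * 1) *\<^sub>R (y n - x)) + (\<Sum>j\<in>UNIV. E n (y n) $ i $ j * w n j (y n)) \<le> b n $ i"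
      using sub[of n] C1_test_add[OF \<phi> C1_test_norm_square[of 1 x]] elim
      unfolding visc_subsolution_def by blast
    ultimately show ?case by linarith
  qed
  ultimately show ?thesis using b by (intro tendsto_le[OF sequentially_bot b]) auto
qed

text \<open>The coupling is linear, so changing the signs of \<open>v\<close> and \<open>p\<close>
  exchanges the two notions and leaves \<open>D\<close> and its sign structure intact. Stability
  then has to be proved for subsolutions only.\<close>

lemma supersolution_iff_reflected_subsolution:
  "visc_supersolution H D c v \<longleftrightarrow>
    visc_subsolution (\<lambda>i x p. - H i x (- p)) D (- c) (\<lambda>i x. - v i x)"
proof -
  have cont: "continuous_on UNIV (\<lambda>x. - v i x) \<longleftrightarrow> continuous_on UNIV (v i)" for i
    using continuous_on_minus[of UNIV "v i"] continuous_on_minus[of UNIV "\<lambda>x. - v i x"] by auto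
  have max: "local_max (\<lambda>y. - v i y - - \<phi> y) x \<longleftrightarrow> local_min (\<lambda>y. v i y - \<phi> y) x" for i \<phi> x
    by (simp add: local_max_def local_min_def) (smt (verit) eventually_mono)
  have sum: "(\<Sum>j\<in>UNIV. D x $ i $ j * - v j x) = - (\<Sum>j\<in>UNIV. D x $ i $ j * v j x)" for i x
    by (simp add: sum_negf)
  show ?thesis
  proof
    assume sup: "visc_supersolution H D c v"
    show "visc_subsolution (\<lambda>i x p. - H i x (- p)) D (- c) (\<lambda>i x. - v i x)"
      unfolding visc_subsolution_def
    proof (intro conjI allI impI)
      fix i x \<phi> G assume *: "C1_test \<phi> G \<and> local_max (\<lambda>y. - v i y - \<phi> y) x"
      then have "C1_test (\<lambda>y. - \<phi> y) (\<lambda>y. - G y)" "local_min (\<lambda>y. v i y - - \<phi> y) x"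
        using C1_test_minus max[where \<phi> = "\<lambda>y. - \<phi> y"] by auto
      then have "c $ i \<le> H i x (- G x) + (\<Sum>j\<in>UNIV. D x $ i $ j * v j x)"
        using sup unfolding visc_supersolution_def by blast
      then show "- H i x (- G x) + (\<Sum>j\<in>UNIV. D x $ i $ j * - v j x) \<le> (- c) $ i"
        unfolding sum by simp
    qed (use sup cont in \<open>simp add: visc_supersolution_def\<close>)
  next
    assume sub: "visc_subsolution (\<lambda>i x p. - H i x (- p)) D (- c) (\<lambda>i x. - v i x)"
    show "visc_supersolution H D c v"
      unfolding visc_supersolution_def
    proof (intro conjI allI impI)
      fix i x \<phi> G assume *: "C1_test \<phi> G \<and> local_min (\<lambda>y. v i y - \<phi> y) x"
      then have "C1_test (\<lambda>y. - \<phi> y) (\<lambda>y. - G y)" "local_max (\<lambda>y. - v i y - - \<phi> y) x"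
        using C1_test_minus max by auto
      then have "- H i x (- (- G x)) + (\<Sum>j\<in>UNIV. D x $ i $ j * - v j x) \<le> (- c) $ i"
        using sub unfolding visc_subsolution_def by blast
      then show "c $ i \<le> H i x (G x) + (\<Sum>j\<in>UNIV. D x $ i $ j * v j x)"
        unfolding sum by simp
    qed (use sub cont in \<open>simp add: visc_subsolution_def\<close>)
  qed
qed

lemma visc_solution_uniform_limit:
  fixes H :: "'m::finite \<Rightarrow> real ^ 'n \<Rightarrow> real ^ 'n \<Rightarrow> real"
  assumes H: "\<And>i. continuous_on UNIV (\<lambda>(x, p). H i x p)"
    and D: "\<And>i j. continuous_on UNIV (\<lambda>x. D x $ i $ j)"
    and sol: "\<And>n. visc_solution H (E n) (b n) (w n)"
    and off: "\<And>n y i j. j \<noteq> i \<Longrightarrow> E n y $ i $ j \<le> 0"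
    and E: "\<And>n y i j. \<bar>E n y $ i $ j - D y $ i $ j\<bar> \<le> e n"
    and b: "b \<longlonglongrightarrow> c" and e: "e \<longlonglongrightarrow> 0"
    and v: "\<And>j. continuous_on UNIV (v j)"
    and w: "\<And>n j y. \<bar>w n j y - v j y\<bar> \<le> e n"
  shows "visc_solution H D c v"
proof -
  have b_lim: "(\<lambda>n. b n $ i) \<longlonglongrightarrow> c $ i" for i by (intro tendsto_vec_nth b)
  have Hr: "continuous_on UNIV (\<lambda>(x, p). - H i x (- p))" for i
    unfolding case_prod_unfold
  proof -
    have "continuous_on UNIV (\<lambda>p :: (real ^ 'n) \<times> (real ^ 'n). (fst p, - snd p))"
      by (intro continuous_intros)
    then show "continuous_on UNIV (\<lambda>p. - H i (fst p) (- snd p))"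
      using continuous_on_compose2[OF H[of i, unfolded case_prod_unfold], of UNIV "\<lambda>p. (fst p, - snd p)"]
      by (intro continuous_on_minus) simp
  qed
  have le: "w n j y \<le> v j y + e n" "v j y - e n \<le> w n j y"
    "- w n j y \<le> - v j y + e n" "- v j y - e n \<le> - w n j y" for n j y
    using w[of n j y] by linarith+
  have "visc_subsolution H D c v"
    unfolding visc_subsolution_def
  proof (intro conjI allI impI)
    fix i x \<phi> G assume *: "C1_test \<phi> G \<and> local_max (\<lambda>y. v i y - \<phi> y) x"
    show "H i x (G x) + (\<Sum>j\<in>UNIV. D x $ i $ j * v j x) \<le> c $ i"
    proof (rule relaxed_limit_subsolution[where E = E and b = b and w = w and e = e])
      show "visc_subsolution H (E n) (b n) (w n)" for n
        using sol[of n] by (simp add: visc_solution_def)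
      show "C1_test \<phi> G" "local_max (\<lambda>y. v i y - \<phi> y) x" using * by auto
    qed (rule off E D e le v H b_lim, assumption?)+
  qed (rule v)
  moreover have "visc_supersolution H D c v"
    unfolding supersolution_iff_reflected_subsolution visc_subsolution_def
  proof (intro conjI allI impI)
    fix i x \<phi> G assume *: "C1_test \<phi> G \<and> local_max (\<lambda>y. - v i y - \<phi> y) x"
    show "- H i x (- G x) + (\<Sum>j\<in>UNIV. D x $ i $ j * - v j x) \<le> (- c) $ i"
    proof (rule relaxed_limit_subsolution[where H = "\<lambda>i x p. - H i x (- p)" and E = E and b = "\<lambda>n. - b n"
          and w = "\<lambda>n i x. - w n i x" and e = e and v = "\<lambda>j x. - v j x"])
      show "visc_subsolution (\<lambda>i x p. - H i x (- p)) (E n) (- b n) (\<lambda>i x. - w n i x)" for n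
        using sol[of n] by (simp add: visc_solution_def supersolution_iff_reflected_subsolution)
      show "(\<lambda>n. (- b n) $ i) \<longlonglongrightarrow> (- c) $ i" using tendsto_minus[OF b_lim] by simp
      show "C1_test \<phi> G" "local_max (\<lambda>y. - v i y - \<phi> y) x" using * by auto
    qed (rule off E D e le Hr continuous_on_minus v, assumption?)+
  qed (intro continuous_on_minus v)
  ultimately show ?thesis by (simp add: visc_solution_def)
qed

section \<open>Perron's construction\<close>

text \<open>If the supersolution test fails at \<open>x\<close>, a slightly lifted and bent test
  function is a subsolution near \<open>x\<close> that exceeds \<open>u i\<close> at
  \<open>x\<close> but not near the boundary of a small ball. Taking the maximum with it enlarges
  \<open>u i\<close>; in the other rows this only lowers the coupling, by the sign of the
  off-diagonal entries.\<close>

lemma perron_bump: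
  fixes H :: "'m::finite \<Rightarrow> real ^ 'n \<Rightarrow> real ^ 'n \<Rightarrow> real"
  assumes H: "\<And>i. continuous_on UNIV (\<lambda>(x, p). H i x p)"
    and D: "\<And>i j. continuous_on UNIV (\<lambda>x. D x $ i $ j)"
    and off: "\<And>x i j. j \<noteq> i \<Longrightarrow> D x $ i $ j \<le> 0"
    and sub: "visc_subsolution H D c u"
    and \<phi>: "C1_test \<phi> G" and min: "local_min (\<lambda>y. u i y - \<phi> y) x"
    and strict: "H i x (G x) + (\<Sum>j\<in>UNIV. D x $ i $ j * u j x) < c $ i" and less: "u i x < B"
  obtains w where "visc_subsolution H D c w" "\<And>j y. u j y \<le> w j y"
    "\<And>j y. u j y \<le> B \<Longrightarrow> w j y \<le> B" "u i x < w i x"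
proof -
  have u: "continuous_on S (u j)" for S j
    using sub unfolding visc_subsolution_def by (meson continuous_on_subset subset_UNIV)
  \<comment> \<open>For \<open>\<eta> = 0\<close> this touches \<open>u i\<close> from below at
    \<open>x\<close>, strictly away from \<open>x\<close> because of the quadratic term;
    \<open>\<eta>\<close> is the height of the lift.\<close>
  define \<psi> where "\<psi> \<eta> y = (\<phi> y + (- 1) * (norm (y - x))\<^sup>2) + (u i x - \<phi> x + \<eta>)" for \<eta> y
  \<comment> \<open>The gradient is independent of \<open>\<eta>\<close>; the final
    \<open>+ 0\<close> is the gradient of the additive constant.\<close>
  define K where "K y = (G y + (2 * (- 1)) *\<^sub>R (y - x)) + 0" for y
  have \<psi>: "C1_test (\<psi> \<eta>) K" for \<eta>
    unfolding \<psi>_def[abs_def] K_def[abs_def] by (intro C1_test_add C1_test_norm_square C1_test_const \<phi>)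
  \<comment> \<open>The left-hand side of equation \<open>i\<close> with component \<open>i\<close>
    replaced by the bump and the other components kept. It is continuous in
    \<open>(y, \<eta>)\<close>, so the strict inequality at \<open>(x, 0)\<close> persists
    nearby.\<close>
  define F where "F = (\<lambda>(y, \<eta>). H i y (K y) + (\<Sum>j\<in>UNIV. D y $ i $ j * u j y) + D y $ i $ i * (\<psi> \<eta> y - u i y))"
  have fst_cont: "continuous_on UNIV (\<lambda>p :: (real ^ 'n) \<times> real. f (fst p))"
    if "continuous_on UNIV f" for f :: "real ^ 'n \<Rightarrow> 'b::topological_space"
    by (rule continuous_on_compose2[OF that]) (auto intro: continuous_intros)
  have cont\<psi>: "continuous_on UNIV (\<lambda>p. \<psi> (snd p) (fst p))"
    unfolding \<psi>_def by (intro continuous_intros fst_cont C1_test_continuous[OF \<phi>])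
  have contH: "continuous_on UNIV (\<lambda>p :: (real ^ 'n) \<times> real. H i (fst p) (K (fst p)))"
  proof -
    have "continuous_on UNIV (\<lambda>y. (y, K y))"
      using C1_test_gradient_continuous[OF \<psi>] by (intro continuous_intros)
    from continuous_on_compose2[OF H this] show ?thesis by (intro fst_cont) simp
  qed
  have contF: "continuous_on UNIV F"
    unfolding F_def case_prod_unfold by (intro continuous_intros contH cont\<psi> fst_cont D u)
  have "open {p. F p < c $ i \<and> \<psi> (snd p) (fst p) < B}"
    by (intro open_Collect_conj open_Collect_less contF cont\<psi> continuous_on_const)
  moreover have "(x, 0) \<in> {p. F p < c $ i \<and> \<psi> (snd p) (fst p) < B}"
    using strict less by (simp add: F_def \<psi>_def K_def)
  ultimately obtain d where d: "0 < d"
    "\<And>p. dist p (x, 0) < d \<Longrightarrow> F p < c $ i \<and> \<psi> (snd p) (fst p) < B"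
    unfolding open_dist by blast
  obtain d' where d': "0 < d'" "\<And>y. dist y x < d' \<Longrightarrow> u i x - \<phi> x \<le> u i y - \<phi> y"
    using min unfolding local_min_def eventually_nhds_metric by blast
  \<comment> \<open>The fractions of \<open>d\<close> keep \<open>(y, \<eta>)\<close> in the
    neighbourhood where \<open>F\<close> is below \<open>c $ i\<close>. Choosing
    \<open>\<eta>\<close> below \<open>r^2\<close> puts the bump under \<open>u i\<close> already
    inside the ball, so the two definitions of \<open>w i\<close> agree on the sphere.\<close>
  define r where "r = Min {d / 4, d' / 2}"
  define \<eta> where "\<eta> = Min {d / 4, r\<^sup>2 / 2}"
  have r: "0 < r" "r \<le> d / 4" "r < d'" using d d' by (auto simp: r_def min_def)
  have \<eta>: "0 < \<eta>" "\<eta> \<le> d / 4" "\<eta> < r\<^sup>2" using d r by (auto simp: \<eta>_def min_def)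
  have near: "F (y, \<eta>) < c $ i" "\<psi> \<eta> y < B" if "y \<in> cball x r" for y
  proof -
    have "dist (y, \<eta>) (x, 0) \<le> dist y x + \<bar>\<eta>\<bar>"
      unfolding dist_Pair_Pair using sqrt_sum_squares_le_sum_abs[of "dist y x" "dist \<eta> 0"] by simp
    also have "\<dots> < d" using that r \<eta> d by (simp add: dist_commute)
    finally show "F (y, \<eta>) < c $ i" "\<psi> \<eta> y < B" using d(2) by fastforce+
  qed
  have outer: "\<psi> \<eta> y \<le> u i y" if "y \<in> cball x r" "\<eta> \<le> (norm (y - x))\<^sup>2" for y
    using d'(2)[of y] that r by (simp add: \<psi>_def dist_commute)
  define w where "w j y = (if j = i \<and> y \<in> cball x r then max (u i y) (\<psi> \<eta> y) else u j y)" for j y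
  have w_ge: "u j y \<le> w j y" for j y by (simp add: w_def)
  have w_other: "w j = u j" if "j \<noteq> i" for j using that by (simp add: w_def fun_eq_iff)
  have sum_w: "(\<Sum>j\<in>UNIV. D y $ k $ j * w j y)
      = (\<Sum>j\<in>UNIV. D y $ k $ j * u j y) + D y $ k $ i * (w i y - u i y)" for y k
  proof -
    have "D y $ k $ j * w j y = D y $ k $ j * u j y + (if j = i then D y $ k $ i * (w i y - u i y) else 0)" for j
      using w_other[of j] by (simp add: algebra_simps)
    then show ?thesis by (simp add: sum.distrib)
  qed
  have w_cont: "continuous_on UNIV (w i)"
  proof -
    have "continuous_on (cball x r \<union> - ball x r) (\<lambda>y. if y \<in> cball x r then max (u i y) (\<psi> \<eta> y) else u i y)"
    proof (rule continuous_on_cases)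
      show "continuous_on (cball x r) (\<lambda>y. max (u i y) (\<psi> \<eta> y))"
        by (intro continuous_intros u C1_test_continuous[OF \<psi>])
      show "\<forall>y. y \<in> cball x r \<and> y \<notin> cball x r \<or> y \<in> - ball x r \<and> y \<in> cball x r \<longrightarrow>
          max (u i y) (\<psi> \<eta> y) = u i y"
      proof (intro allI impI)
        fix y assume "y \<in> cball x r \<and> y \<notin> cball x r \<or> y \<in> - ball x r \<and> y \<in> cball x r"
        then have "y \<in> cball x r" "norm (y - x) = r" by (auto simp: dist_norm norm_minus_commute)
        then show "max (u i y) (\<psi> \<eta> y) = u i y" using outer[of y] \<eta>(3) by simp
      qed
    qed (auto intro: u)
    moreover have "cball x r \<union> - ball x r = UNIV" by auto
    moreover have "w i = (\<lambda>y. if y \<in> cball x r then max (u i y) (\<psi> \<eta> y) else u i y)"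
      by (simp add: w_def fun_eq_iff)
    ultimately show ?thesis by simp
  qed
  have "visc_subsolution H D c w"
    unfolding visc_subsolution_def
  proof (intro conjI allI impI)
    show "continuous_on UNIV (w j)" for j
      using w_cont w_other u by (cases "j = i") auto
    fix k y \<theta> X assume *: "C1_test \<theta> X \<and> local_max (\<lambda>z. w k z - \<theta> z) y"
    show "H k y (X y) + (\<Sum>j\<in>UNIV. D y $ k $ j * w j y) \<le> c $ k"
    proof (cases "w k y = u k y")
      \<comment> \<open>The tested component equals \<open>u k\<close> at \<open>y\<close>, so the
        test passes to \<open>u\<close>. The extra coupling term is nonpositive for
        \<open>k \<noteq> i\<close> and zero for \<open>k = i\<close>.\<close>
      case True
      have "local_max (\<lambda>z. u k z - \<theta> z) y"
        using * True w_ge[of k] by (intro local_max_cong[OF conjunct2[OF *]] always_eventually) auto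
      then have "H k y (X y) + (\<Sum>j\<in>UNIV. D y $ k $ j * u j y) \<le> c $ k"
        using sub * unfolding visc_subsolution_def by blast
      moreover have "D y $ k $ i * (w i y - u i y) \<le> 0"
        using off[of i k y] w_ge[of i y] True by (cases "i = k") (auto intro: mult_nonpos_nonneg)
      ultimately show ?thesis unfolding sum_w by linarith
    next
      \<comment> \<open>The bump is active at \<open>y\<close>, which must then lie in the open
        ball. The test passes to the smooth function \<open>\<psi> \<eta>\<close>, whose gradient
        equals that of the test function.\<close>
      case False
      then have [simp]: "k = i" using w_other by metis
      from False have y: "y \<in> cball x r" "w i y = \<psi> \<eta> y" "u i y < \<psi> \<eta> y"
        by (auto simp: w_def max_def split: if_splits)
      then have "(norm (y - x))\<^sup>2 < r\<^sup>2" using outer[of y] \<eta>(3) by fastforce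
      then have "norm (y - x) < r" using r(1) by (simp add: power2_less_imp_less)
      then have "y \<in> ball x r" by (simp add: dist_norm norm_minus_commute)
      then have "\<forall>\<^sub>F z in nhds y. z \<in> ball x r" by (intro eventually_nhds_in_open) auto
      then have "\<forall>\<^sub>F z in nhds y. \<psi> \<eta> z - \<theta> z - (\<psi> \<eta> y - \<theta> y) \<le> w i z - \<theta> z - (w i y - \<theta> y)"
        by eventually_elim (simp add: y(2), simp add: w_def)
      then have "local_max (\<lambda>z. \<psi> \<eta> z - \<theta> z) y"
        using * by (intro local_max_cong[OF conjunct2[OF *]]) simp
      then have "K y = X y" using C1_test_local_max_gradient[OF \<psi>] * by blast
      then show ?thesis
        using near(1)[OF y(1)] unfolding sum_w by (simp add: F_def y(2))
    qed
  qed
  moreover have "w j y \<le> B" if "u j y \<le> B" for j y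
    using that near(2)[of y] by (auto simp: w_def)
  moreover have "u i x < w i x"
    using r \<eta>(1) by (simp add: w_def \<psi>_def)
  ultimately show thesis using w_ge that by blast
qed

text \<open>The hypothesis \<open>lip\<close> makes the supremum continuous, so no semicontinuous
  envelopes occur. The constant \<open>a\<close> provides a member of the class, and the constant
  supersolution \<open>B\<close> caps it.\<close>

lemma perron:
  fixes H :: "'m::finite \<Rightarrow> real ^ 'n \<Rightarrow> real ^ 'n \<Rightarrow> real"
  assumes H: "\<And>i. continuous_on UNIV (\<lambda>(x, p). H i x p)"
    and D: "\<And>i j. continuous_on UNIV (\<lambda>x. D x $ i $ j)"
    and off: "\<And>x i j. j \<noteq> i \<Longrightarrow> D x $ i $ j \<le> 0"
    and perH: "\<And>i. torus_fun (H i)" and perD: "\<And>i j. torus_fun (\<lambda>x. D x $ i $ j)"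
    and sub0: "visc_subsolution H D c (\<lambda>_ _. a)" and "a \<le> B"
    and super: "\<And>i x. c $ i \<le> H i x 0 + (\<Sum>j\<in>UNIV. D x $ i $ j * B)"
    and lip: "\<And>w i. visc_subsolution H D c w \<Longrightarrow> (\<And>i x. a \<le> w i x \<and> w i x \<le> B) \<Longrightarrow> L-lipschitz_on UNIV (w i)"
  obtains u where "visc_solution H D c u" "\<And>i. torus_fun (u i)" "\<And>i x. a \<le> u i x \<and> u i x \<le> B"
proof -
  define S where "S = {w. visc_subsolution H D c w \<and> (\<forall>i x. a \<le> w i x \<and> w i x \<le> B)}"
  define u where "u i x = (SUP w\<in>S. w i x)" for i x
  have S0: "(\<lambda>_ _. a) \<in> S" using sub0 \<open>a \<le> B\<close> by (simp add: S_def)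
  have bdd: "bdd_above ((\<lambda>w. w i x) ` S)" for i x
    by (rule bdd_aboveI[of _ B]) (auto simp: S_def)
  have upper: "w i x \<le> u i x" if "w \<in> S" for w i x
    unfolding u_def by (rule cSUP_upper[OF that bdd])
  have least: "u i x \<le> b" if "\<And>w. w \<in> S \<Longrightarrow> w i x \<le> b" for i x b
    unfolding u_def by (rule cSUP_least) (use S0 that in auto)
  have u_bounds: "a \<le> u i x \<and> u i x \<le> B" for i x
    using upper[OF S0] least[of i x B] by (auto simp: S_def)
  have u_lip: "L-lipschitz_on UNIV (u i)" for i
  proof (rule lipschitz_onI)
    have wl: "L-lipschitz_on UNIV (w i)" if "w \<in> S" for w
      using that lip by (simp add: S_def)
    show "0 \<le> L" using wl[OF S0] by (rule lipschitz_on_nonneg)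
    have le: "u i x \<le> u i y + L * dist x y" for x y
    proof (rule least)
      fix w assume w: "w \<in> S"
      have "dist (w i x) (w i y) \<le> L * dist x y" by (rule lipschitz_onD[OF wl[OF w]]) auto
      then show "w i x \<le> u i y + L * dist x y" using upper[OF w, of i y] by (simp add: dist_real_def)
    qed
    show "dist (u i x) (u i y) \<le> L * dist x y" for x y
      using le[of x y] le[of y x] by (simp add: dist_real_def dist_commute abs_le_iff)
  qed
  then have u_cont: "continuous_on UNIV (u i)" for i by (rule lipschitz_on_continuous_on)
  have sub: "visc_subsolution H D c u"
    unfolding visc_subsolution_def
  proof (intro conjI allI impI)
    fix i x \<phi> G assume *: "C1_test \<phi> G \<and> local_max (\<lambda>y. u i y - \<phi> y) x"
    define e where "e n = inverse (real (Suc n))" for n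
    \<comment> \<open>Members nearly attaining the supremum at the single point \<open>x\<close>, in
      component \<open>i\<close> only, suffice for the relaxed limit.\<close>
    have "\<exists>w\<in>S. u i x - e n \<le> w i x" for n
    proof (rule ccontr)
      assume "\<not> (\<exists>w\<in>S. u i x - e n \<le> w i x)"
      then have "u i x \<le> u i x - e n" by (intro least) force
      then show False by (simp add: e_def)
    qed
    then obtain w where w: "\<And>n. w n \<in> S" "\<And>n. u i x - e n \<le> w n i x" by metis
    show "H i x (G x) + (\<Sum>j\<in>UNIV. D x $ i $ j * u j x) \<le> c $ i"
    proof (rule relaxed_limit_subsolution[where E = "\<lambda>_. D" and b = "\<lambda>_. c" and w = w and e = e])
      show "visc_subsolution H D c (w n)" for n using w(1)[of n] by (simp add: S_def)
      show "\<bar>D y $ i $ j - D y $ i $ j\<bar> \<le> e n" for n y j by (simp add: e_def)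
      show "e \<longlonglongrightarrow> 0" unfolding e_def by (rule LIMSEQ_inverse_real_of_nat)
      show "w n j y \<le> u j y + e n" for n j y
        using upper[OF w(1), of n j y] by (simp add: e_def add_increasing2)
      show "C1_test \<phi> G" "local_max (\<lambda>y. u i y - \<phi> y) x" using * by auto
    qed (rule H D off u_cont w(2) tendsto_const, assumption?)+
  qed (rule u_cont)
  moreover have "visc_supersolution H D c u"
    unfolding visc_supersolution_def
  proof (intro conjI allI impI)
    fix i x \<phi> G assume *: "C1_test \<phi> G \<and> local_min (\<lambda>y. u i y - \<phi> y) x"
    show "c $ i \<le> H i x (G x) + (\<Sum>j\<in>UNIV. D x $ i $ j * u j x)"
    proof (cases "u i x < B")
      case True
      show ?thesis
      proof (rule ccontr)
        assume "\<not> ?thesis"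
        then have "H i x (G x) + (\<Sum>j\<in>UNIV. D x $ i $ j * u j x) < c $ i" by simp
        then obtain w where w: "visc_subsolution H D c w" "\<And>j y. u j y \<le> w j y"
          "\<And>j y. u j y \<le> B \<Longrightarrow> w j y \<le> B" "u i x < w i x"
          using perron_bump[OF H D off sub _ _ _ True, of \<phi> G] * by blast
        have "a \<le> w j y" for j y using w(2)[of j y] u_bounds[of j y] by linarith
        then have "w \<in> S" using w(1,3) u_bounds by (simp add: S_def)
        then show False using upper[of w i x] w(4) by simp
      qed
    next
      text \<open>No bump is admissible here, but \<open>u\<close> touches the constant supersolution \<open>B\<close>.\<close>
      case False
      then have uB: "u i x = B" using u_bounds[of i x] by simp
      have "\<forall>\<^sub>F y in nhds x. \<phi> y - 0 \<le> \<phi> x - 0"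
        using * unfolding local_min_def by (auto elim!: eventually_mono) (smt (verit) u_bounds uB)
      then have "G x = 0"
        using * C1_test_local_max_gradient[OF _ C1_test_const[of 0], of \<phi> G x] by (simp add: local_max_def)
      moreover have "(\<Sum>j\<in>UNIV. D x $ i $ j * B) \<le> (\<Sum>j\<in>UNIV. D x $ i $ j * u j x)"
      proof (rule sum_mono)
        show "D x $ i $ j * B \<le> D x $ i $ j * u j x" for j
          using off[of j i x] u_bounds[of j x] uB by (cases "j = i") (auto intro: mult_left_mono_neg)
      qed
      ultimately show ?thesis using super[of i x] by simp
    qed
  qed (rule u_cont)
  moreover have "torus_fun (u i)" for i
  proof -
    \<comment> \<open>An integer translate of a member of \<open>S\<close> is again a member. Using
      this for both \<open>k\<close> and \<open>- k\<close> gives periodicity.\<close>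
    have shift: "u i (x + k) \<le> u i x" if k: "\<forall>l. k $ l \<in> \<int>" for x k
    proof (rule least)
      fix w assume w: "w \<in> S"
      have "visc_subsolution H D c (\<lambda>j y. w j (y + k))"
        unfolding visc_subsolution_def
      proof (intro conjI allI impI)
        have wc: "continuous_on UNIV (w j)" for j using w by (simp add: S_def visc_subsolution_def)
        show "continuous_on UNIV (\<lambda>y. w j (y + k))" for j
          by (rule continuous_on_compose2[OF wc]) (auto intro: continuous_intros)
        fix j y \<phi> G assume *: "C1_test \<phi> G \<and> local_max (\<lambda>z. w j (z + k) - \<phi> z) y"
        have "C1_test (\<lambda>z. \<phi> (z - k)) (\<lambda>z. G (z - k))"
        proof (rule C1_testI)
          have "((\<lambda>z. z - k) has_derivative (\<lambda>h. h)) (at z)" for z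
            by (auto intro!: derivative_eq_intros)
          then show "((\<lambda>z. \<phi> (z - k)) has_derivative (\<lambda>h. h \<bullet> G (z - k))) (at z)" for z
            using has_derivative_compose C1_test_has_derivative[of \<phi> G "z - k"] * by blast
          show "continuous_on UNIV (\<lambda>z. G (z - k))"
            using * by (intro continuous_on_compose2[OF C1_test_gradient_continuous[of \<phi> G]])
              (auto intro: continuous_intros)
        qed
        moreover have "local_max (\<lambda>z. w j z - \<phi> (z - k)) (y + k)"
        proof -
          obtain d where d: "0 < d" "\<And>z. dist z y < d \<Longrightarrow> w j (z + k) - \<phi> z \<le> w j (y + k) - \<phi> y"
            using * unfolding local_max_def eventually_nhds_metric by blast
          have "w j z - \<phi> (z - k) \<le> w j (y + k) - \<phi> y" if "dist z (y + k) < d" for z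
            using d(2)[of "z - k"] that by (simp add: dist_norm algebra_simps)
          then show ?thesis unfolding local_max_def eventually_nhds_metric using d(1) by auto
        qed
        ultimately have "H j (y + k) (G (y + k - k)) + (\<Sum>l\<in>UNIV. D (y + k) $ j $ l * w l (y + k)) \<le> c $ j"
          using w unfolding S_def visc_subsolution_def by blast
        then show "H j y (G y) + (\<Sum>l\<in>UNIV. D y $ j $ l * w l (y + k)) \<le> c $ j"
          using torus_funD[OF perH k] torus_funD[OF perD k] by simp
      qed
      then have "(\<lambda>j y. w j (y + k)) \<in> S" using w by (simp add: S_def)
      from upper[OF this] show "w i (x + k) \<le> u i x" .
    qed
    show ?thesis
      unfolding torus_fun_def
    proof (intro allI impI antisym)
      fix x k :: "real ^ 'n" assume k: "\<forall>l. k $ l \<in> \<int>"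
      show "u i (x + k) \<le> u i x" by (rule shift[OF k])
      have "\<forall>l. (- k) $ l \<in> \<int>" using k by simp
      from shift[OF this, of "x + k"] show "u i x \<le> u i (x + k)" by simp
    qed
  qed
  ultimately show thesis using u_bounds that by (auto simp: visc_solution_def)
qed

section \<open>The discounted system\<close>

text \<open>There may be no test function touching \<open>w i\<close> at \<open>x\<close> itself.
  Steep paraboloids centred at \<open>x\<close> touch it at nearby points, where the lower bound on
  \<open>H\<close> controls the coupling; continuity carries the estimate to
  \<open>x\<close>.\<close>

lemma subsolution_coupling_bound:
  fixes H :: "'m::finite \<Rightarrow> real ^ 'n \<Rightarrow> real ^ 'n \<Rightarrow> real"
  assumes sub: "visc_subsolution H D c w" and D: "\<And>i j. continuous_on UNIV (\<lambda>x. D x $ i $ j)"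
    and low: "\<And>i x p. - K \<le> H i x p" and bnd: "\<And>x. \<bar>w i x\<bar> \<le> B"
  shows "(\<Sum>j\<in>UNIV. D x $ i $ j * w j x) \<le> c $ i + K"
proof -
  have w: "continuous_on UNIV (w j)" for j using sub by (simp add: visc_subsolution_def)
  have "0 \<le> B" using bnd[of x] by linarith
  have "\<exists>y. \<forall>z. w i z - real (Suc n) * (norm (z - x))\<^sup>2 \<le> w i y - real (Suc n) * (norm (y - x))\<^sup>2" for n
  proof (rule attains_max_of_decay)
    show "continuous_on UNIV (\<lambda>y. w i y - real (Suc n) * (norm (y - x))\<^sup>2)"
      by (intro continuous_intros w)
    \<comment> \<open>Beyond this radius the distance \<open>t\<close> is at least 1 and at least
      \<open>2 * B\<close>, so the penalty dominates \<open>t\<close> and hence the oscillation of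
      \<open>w i\<close>.\<close>
    fix z assume "1 + 2 * B < dist x z"
    then have z: "1 + 2 * B < norm (z - x)" by (simp add: dist_norm norm_minus_commute)
    then have "2 * B \<le> 1 * norm (z - x)" by simp
    also have "\<dots> \<le> norm (z - x) * norm (z - x)" using z \<open>0 \<le> B\<close> by (intro mult_right_mono) auto
    also have "\<dots> \<le> real (Suc n) * (norm (z - x))\<^sup>2"
      by (simp add: power2_eq_square mult_le_cancel_right1)
    finally show "w i z - real (Suc n) * (norm (z - x))\<^sup>2 \<le> w i x - real (Suc n) * (norm (x - x))\<^sup>2"
      using bnd[of x] bnd[of z] by simp
  qed
  then obtain y where y: "\<And>n z. w i z - real (Suc n) * (norm (z - x))\<^sup>2 \<le> w i (y n) - real (Suc n) * (norm (y n - x))\<^sup>2"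
    by metis
  have dist_le: "norm (y n - x) \<le> sqrt (2 * B * inverse (real (Suc n)))" for n
  proof -
    have "real (Suc n) * (norm (y n - x))\<^sup>2 \<le> 2 * B"
      using y[where z = x and n = n] bnd[of x] bnd[of "y n"] by simp
    then have "(norm (y n - x))\<^sup>2 \<le> 2 * B * inverse (real (Suc n))"
      by (simp add: field_simps)
    then show ?thesis by (rule real_le_rsqrt)
  qed
  have "(\<lambda>n. sqrt (2 * B * inverse (real (Suc n)))) \<longlonglongrightarrow> 0"
    using tendsto_real_sqrt[OF tendsto_mult_right_zero[OF LIMSEQ_inverse_real_of_nat, of "2 * B"]] by simp
  then have "(\<lambda>n. y n - x) \<longlonglongrightarrow> 0"
    by (rule Lim_null_comparison[rotated]) (simp only: dist_le eventually_True)
  then have y_lim: "y \<longlonglongrightarrow> x" by (rule LIM_zero_cancel)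
  have le: "(\<Sum>j\<in>UNIV. D (y n) $ i $ j * w j (y n)) \<le> c $ i + K" for n
  proof -
    have "local_max (\<lambda>z. w i z - real (Suc n) * (norm (z - x))\<^sup>2) (y n)"
      unfolding local_max_def using y by simp
    then have "H i (y n) ((2 * real (Suc n)) *\<^sub>R (y n - x)) + (\<Sum>j\<in>UNIV. D (y n) $ i $ j * w j (y n)) \<le> c $ i"
      using sub C1_test_norm_square[of "real (Suc n)" x] unfolding visc_subsolution_def by blast
    then show ?thesis using low[of i "y n" "(2 * real (Suc n)) *\<^sub>R (y n - x)"] by linarith
  qed
  have "(\<lambda>n. \<Sum>j\<in>UNIV. D (y n) $ i $ j * w j (y n)) \<longlonglongrightarrow> (\<Sum>j\<in>UNIV. D x $ i $ j * w j x)"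
    by (intro tendsto_intros tendsto_compose_UNIV[OF D y_lim] tendsto_compose_UNIV[OF w y_lim])
  then show ?thesis using le by (intro LIMSEQ_le_const2) auto
qed

lemma discount_nth: "(A + l *\<^sub>R mat 1) $ i $ j = A $ i $ j + (if i = j then l else 0)"
  by (simp add: mat_def)

lemma discount_sum:
  "(\<Sum>j\<in>UNIV. (A + l *\<^sub>R mat 1) $ i $ j * z j) = (\<Sum>j\<in>UNIV. A $ i $ j * z j) + l * z i"
proof -
  have "(A + l *\<^sub>R mat 1) $ i $ j * z j = A $ i $ j * z j + (if i = j then l * z j else 0)" for j
    unfolding discount_nth by (simp add: algebra_simps)
  then show ?thesis by (simp add: sum.distrib)
qed

text \<open>The bounds \<open>R\<close>, \<open>K\<close>, \<open>M\<close> are fixed before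
  \<open>l\<close>. Since \<open>D\<close> annihilates constant vectors and \<open>M\<close> bounds
  all \<open>H i x 0\<close>, the constants \<open>- M / l\<close> and \<open>M / l\<close> serve as
  barriers in Perron's method.\<close>

lemma discounted_solutions:
  fixes H :: "'m::finite \<Rightarrow> real ^ 'n \<Rightarrow> real ^ 'n \<Rightarrow> real"
    and D :: "real ^ 'n \<Rightarrow> real ^ 'm ^ 'm"
  assumes per: "\<And>i j. torus_fun (\<lambda>x. D x $ i $ j)"
    and cont: "\<And>i j. continuous_on UNIV (\<lambda>x. D x $ i $ j)"
    and mon: "\<And>x. monotone_matrix (D x)" and irr: "\<And>x. irreducible_matrix (D x)"
    and ham: "\<And>i. hamiltonian (H i)" and coer: "\<And>i. coercive (H i)"
  obtains R K M where
    "\<forall>l>0. \<exists>u. visc_solution H (\<lambda>x. D x + l *\<^sub>R mat 1) 0 u \<and> (\<forall>i. torus_fun (u i)) \<and>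
      (\<forall>i. R-lipschitz_on UNIV (u i)) \<and> (\<forall>i j x. u i x - u j x \<le> K) \<and> (\<forall>i x. \<bar>l * u i x\<bar> \<le> M)"
proof -
  have contH: "continuous_on UNIV (\<lambda>(x, p). H i x p)" and perH: "torus_fun (H i)" for i
    using ham by (auto simp: hamiltonian_def)
  obtain M where M: "0 \<le> M" "\<And>i. \<forall>x. \<bar>H i x 0\<bar> \<le> M"
  proof (rule uniform_bound_finite[where P = "\<lambda>i B. \<forall>x. \<bar>H i x 0\<bar> \<le> B"])
    show "\<exists>B. \<forall>x. \<bar>H i x 0\<bar> \<le> B" for i
      using hamiltonian_bounded[OF ham, of 0 i] by (metis norm_zero order_refl)
  qed (auto intro: order_trans)
  obtain K0 where K0: "0 \<le> K0" "\<And>i. \<forall>x p. - K0 \<le> H i x p"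
  proof (rule uniform_bound_finite[where P = "\<lambda>i B. \<forall>x p. - B \<le> H i x p"])
    show "\<exists>B. \<forall>x p. - B \<le> H i x p" for i
      using hamiltonian_bounded_below[OF ham coer, of i] by metis
    show "\<forall>x p. - B' \<le> H i x p" if "\<forall>x p. - B \<le> H i x p" "B \<le> B'" for i B B'
      using that by (meson neg_le_iff_le order_trans)
  qed auto
  obtain d where d: "0 \<le> d" "\<And>i. \<forall>j x. \<bar>D x $ i $ j\<bar> \<le> d"
  proof (rule uniform_bound_finite[where P = "\<lambda>i B. \<forall>j x. \<bar>D x $ i $ j\<bar> \<le> B"])
    fix i
    obtain B where "0 \<le> B" "\<And>j. \<forall>x. \<bar>D x $ i $ j\<bar> \<le> B"
    proof (rule uniform_bound_finite[where P = "\<lambda>j B. \<forall>x. \<bar>D x $ i $ j\<bar> \<le> B"])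
      show "\<exists>B. \<forall>x. \<bar>D x $ i $ j\<bar> \<le> B" for j using torus_bounded[OF per cont] by metis
    qed (auto intro: order_trans)
    then show "\<exists>B. \<forall>j x. \<bar>D x $ i $ j\<bar> \<le> B" by blast
  qed (blast intro: order_trans)+
  obtain \<kappa> where \<kappa>: "0 \<le> \<kappa>"
    "\<And>x z C i j. 0 \<le> C \<Longrightarrow> (\<And>i. (\<Sum>j\<in>UNIV. D x $ i $ j * z j) \<le> C) \<Longrightarrow> z i - z j \<le> \<kappa> * C"
    using irreducible_oscillation_bound[OF per cont mon irr] by blast
  \<comment> \<open>For a subsolution between the barriers each coupling sum is at most
    \<open>K0 + M\<close>: \<open>K0\<close> from the lower bound on \<open>H\<close>, and
    \<open>M\<close> from the discount term.\<close>
  define K where "K = \<kappa> * (K0 + M)"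
  have "0 \<le> K" using \<kappa>(1) K0(1) M(1) by (simp add: K_def)
  \<comment> \<open>The threshold is the largest value of \<open>H\<close> that a test can see: the
    discount contributes at most \<open>M\<close>, and each coupling term at most
    \<open>d * K\<close>.\<close>
  obtain R where R: "0 \<le> R" "\<And>i. \<forall>x p. H i x p \<le> M + real CARD('m) * (d * K) \<longrightarrow> norm p \<le> R"
  proof (rule uniform_bound_finite[where P = "\<lambda>i B. \<forall>x p. H i x p \<le> M + real CARD('m) * (d * K) \<longrightarrow> norm p \<le> B"])
    show "\<exists>B. \<forall>x p. H i x p \<le> M + real CARD('m) * (d * K) \<longrightarrow> norm p \<le> B" for i
      using coercive_radius[OF coer, of i] by metis
  qed (blast intro: order_trans)+
  have "\<exists>u. visc_solution H (\<lambda>x. D x + l *\<^sub>R mat 1) 0 u \<and> (\<forall>i. torus_fun (u i)) \<and>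
      (\<forall>i. R-lipschitz_on UNIV (u i)) \<and> (\<forall>i j x. u i x - u j x \<le> K) \<and> (\<forall>i x. \<bar>l * u i x\<bar> \<le> M)"
    if l: "0 < l" for l
  proof -
    let ?E = "\<lambda>x. D x + l *\<^sub>R mat 1"
    have contE: "continuous_on UNIV (\<lambda>x. ?E x $ i $ j)" for i j
      unfolding discount_nth by (intro continuous_intros cont)
    have perE: "torus_fun (\<lambda>x. ?E x $ i $ j)" for i j
      using per[of i j] unfolding discount_nth by (simp add: torus_fun_def)
    have offE: "?E x $ i $ j \<le> 0" if "j \<noteq> i" for x i j
      using mon[of x] that unfolding discount_nth by (simp add: monotone_matrix_def)
    have Msum: "(\<Sum>j\<in>UNIV. D x $ i $ j * a) = 0" for x i a
      using mon[of x] by (simp add: monotone_matrix_def flip: sum_distrib_right)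
    have osc: "w i x - w j x \<le> K"
      if "visc_subsolution H ?E 0 w" and bnd: "\<And>i x. - M / l \<le> w i x \<and> w i x \<le> M / l" for w i j x
      unfolding K_def
    proof (rule \<kappa>(2)[of _ x "\<lambda>j. w j x"])
      show "0 \<le> K0 + M" using K0(1) M(1) by simp
      fix i
      \<comment> \<open>The bound \<open>M / l\<close> is not uniform in \<open>l\<close>, but it
        does not enter the conclusion of the lemma applied here.\<close>
      have "(\<Sum>j\<in>UNIV. ?E x $ i $ j * w j x) \<le> 0 $ i + K0"
        using bnd by (intro subsolution_coupling_bound[OF that(1) contE, where B = "M / l"])
          (use K0 in \<open>auto simp: abs_le_iff minus_le_iff\<close>)
      moreover have "- M \<le> l * w i x" using bnd[of i x] l by (simp add: field_simps)
      ultimately show "(\<Sum>j\<in>UNIV. D x $ i $ j * w j x) \<le> K0 + M"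
        unfolding discount_sum by simp
    qed
    have lip: "R-lipschitz_on UNIV (w i)"
      if sub: "visc_subsolution H ?E 0 w" and bnd: "\<And>i x. - M / l \<le> w i x \<and> w i x \<le> M / l" for w i
    proof (rule lipschitz_of_gradient_bound[OF _ _ R(1)])
      show "continuous_on UNIV (w i)" using sub by (simp add: visc_subsolution_def)
      show "\<bar>w i x\<bar> \<le> M / l" for x using bnd[of i x] by (simp add: abs_le_iff minus_le_iff)
      fix x \<phi> G assume "C1_test \<phi> G" "local_max (\<lambda>y. w i y - \<phi> y) x"
      then have le: "H i x (G x) + (\<Sum>j\<in>UNIV. ?E x $ i $ j * w j x) \<le> 0 $ i"
        using sub unfolding visc_subsolution_def by blast
      \<comment> \<open>Zero row sums allow the values \<open>w j x\<close>, possibly of order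
        \<open>1 / l\<close>, to be replaced by differences bounded by \<open>K\<close>.\<close>
      have "\<bar>D x $ i $ j * (w j x - w i x)\<bar> \<le> d * K" for j
        unfolding abs_mult using d osc[OF sub bnd, of i x j] osc[OF sub bnd, of j x i]
        by (intro mult_mono) auto
      then have "(\<Sum>j\<in>(UNIV :: 'm set). - (d * K)) \<le> (\<Sum>j\<in>UNIV. D x $ i $ j * (w j x - w i x))"
        by (intro sum_mono) (simp add: abs_le_iff minus_le_iff)
      also have "\<dots> = (\<Sum>j\<in>UNIV. D x $ i $ j * w j x)" by (rule monotone_sum_diff[OF mon])
      finally have "- (real CARD('m) * (d * K)) \<le> (\<Sum>j\<in>UNIV. D x $ i $ j * w j x)" by simp
      moreover have "- M \<le> l * w i x" using bnd[of i x] l by (simp add: field_simps)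
      ultimately have "H i x (G x) \<le> M + real CARD('m) * (d * K)"
        using le unfolding discount_sum by simp
      then show "norm (G x) \<le> R" using R(2) by blast
    qed
    obtain u where u: "visc_solution H ?E 0 u" "\<And>i. torus_fun (u i)" "\<And>i x. - M / l \<le> u i x \<and> u i x \<le> M / l"
    proof (rule perron[where H = H and D = ?E and c = 0 and a = "- M / l" and B = "M / l" and L = R])
      show "visc_subsolution H ?E 0 (\<lambda>_ _. - M / l)"
        unfolding visc_subsolution_def
      proof (intro conjI allI impI)
        fix i \<phi> G and x :: "real ^ 'n"
        assume "C1_test \<phi> G \<and> local_max (\<lambda>y. - M / l - \<phi> y) x"
        then have "G x = 0" using C1_test_local_max_gradient[OF C1_test_const, of \<phi> G "- M / l" x] by simp
        moreover have "l * (- M / l) = - M" using l by simp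
        ultimately show "H i x (G x) + (\<Sum>j\<in>UNIV. ?E x $ i $ j * (- M / l)) \<le> 0 $ i"
          using M(2)[of i] unfolding discount_sum Msum by (simp add: abs_le_iff)
      qed simp
      show "- M / l \<le> M / l" using l M(1) by (simp add: field_simps)
      show "0 $ i \<le> H i x 0 + (\<Sum>j\<in>UNIV. ?E x $ i $ j * (M / l))" for i x
        using M(2)[rule_format, of i x] l unfolding discount_sum Msum by (simp add: abs_le_iff)
      show "R-lipschitz_on UNIV (w i)" if "visc_subsolution H ?E 0 w"
        and "\<And>i x. - M / l \<le> w i x \<and> w i x \<le> M / l" for w i
        using that by (rule lip)
      show "?E x $ i $ j \<le> 0" if "j \<noteq> i" for x i j using that by (rule offE)
    qed (rule contH contE perH perE | rule that; assumption)+
    have usub: "visc_subsolution H ?E 0 u" using u(1) by (simp add: visc_solution_def)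
    have "\<bar>l * u i x\<bar> \<le> M" for i x using u(3)[of i x] l by (simp add: field_simps abs_le_iff)
    then show ?thesis using u lip[OF usub u(3)] osc[OF usub u(3)] by blast
  qed
  then show thesis by (intro that) blast
qed

text \<open>Equal row sums turn a constant shift into a change of the right-hand side. For the
  discounted matrix \<open>s = l\<close>, so subtracting a constant of order \<open>1 / l\<close>
  moves the right-hand side by a bounded amount.\<close>

lemma visc_solution_shift:
  fixes H :: "'m::finite \<Rightarrow> real ^ 'n \<Rightarrow> real ^ 'n \<Rightarrow> real"
  assumes sum: "\<And>x i. (\<Sum>j\<in>UNIV. D x $ i $ j) = s" and sol: "visc_solution H D c u"
  shows "visc_solution H D (\<chi> i. c $ i - s * a) (\<lambda>i x. u i x - a)"
proof -
  have eq: "(\<Sum>j\<in>UNIV. D x $ i $ j * (u j x - a)) = (\<Sum>j\<in>UNIV. D x $ i $ j * u j x) - s * a" for x i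
    using sum[of x i] by (simp add: right_diff_distrib sum_subtractf flip: sum_distrib_right)
  have max: "local_max (\<lambda>y. u i y - a - \<phi> y) x \<longleftrightarrow> local_max (\<lambda>y. u i y - \<phi> y) x"
    and min: "local_min (\<lambda>y. u i y - a - \<phi> y) x \<longleftrightarrow> local_min (\<lambda>y. u i y - \<phi> y) x" for i \<phi> x
    by (simp_all add: local_max_def local_min_def algebra_simps)
  show ?thesis
    using sol unfolding visc_solution_def visc_subsolution_def visc_supersolution_def eq max min
    by (auto intro!: continuous_intros simp: algebra_simps)
qed

section \<open>Comparison of ergodic constants\<close>

lemma W1inf_torus_bounds:
  fixes v :: "'m::finite \<Rightarrow> real ^ 'n \<Rightarrow> real"
  assumes "v \<in> W1inf_torus"
  obtains V L where "\<And>i x. \<bar>v i x\<bar> \<le> V" "0 \<le> L" "\<And>i x y. \<bar>v i x - v i y\<bar> \<le> L * norm (x - y)"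
proof -
  obtain V where V: "\<And>i. \<forall>x. \<bar>v i x\<bar> \<le> V"
  proof (rule uniform_bound_finite[where P = "\<lambda>i B. \<forall>x. \<bar>v i x\<bar> \<le> B"])
    fix i
    have "torus_fun (v i)" "continuous_on UNIV (v i)"
      using assms by (auto simp: W1inf_torus_def intro: lipschitz_on_continuous_on)
    then show "\<exists>B. \<forall>x. \<bar>v i x\<bar> \<le> B" using torus_bounded by metis
  qed (blast intro: order_trans)+
  obtain L where L: "0 \<le> L" "\<And>i. L-lipschitz_on UNIV (v i)"
  proof (rule uniform_bound_finite[where P = "\<lambda>i B. B-lipschitz_on UNIV (v i)"])
    show "\<exists>B. B-lipschitz_on UNIV (v i)" for i
      using assms by (auto simp: W1inf_torus_def)
  qed (auto intro: lipschitz_on_le)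
  have "\<bar>v i x - v i y\<bar> \<le> L * norm (x - y)" for i x y
    using lipschitz_onD[OF L(2), of x y i] by (simp add: dist_norm)
  then show thesis using V L(1) that by blast
qed

text \<open>In the variables \<open>(x, h) = (x, y - x)\<close> the penalised difference is periodic in \<open>x\<close> and small for large
  \<open>h\<close>, so its maximum is attained on a compact set.\<close>

lemma doubling_max:
  fixes v w :: "'m::finite \<Rightarrow> real ^ 'n \<Rightarrow> real"
  assumes v: "v \<in> W1inf_torus" and w: "w \<in> W1inf_torus" and k: "0 < k"
  obtains i x y where "x \<in> cbox 0 1"
    "\<And>j x' y'. v j x' - w j y' - k * (norm (x' - y'))\<^sup>2 \<le> v i x - w i y - k * (norm (x - y))\<^sup>2"
proof -
  obtain V where V: "\<And>i x. \<bar>v i x\<bar> \<le> V" using W1inf_torus_bounds[OF v] by metis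
  obtain W where W: "\<And>i x. \<bar>w i x\<bar> \<le> W" using W1inf_torus_bounds[OF w] by metis
  have vc: "continuous_on S (v i)" and wc: "continuous_on S (w i)" for i S
    using v w lipschitz_on_continuous_on continuous_on_subset
    unfolding W1inf_torus_def by blast+
  have vp: "torus_fun (v i)" and wp: "torus_fun (w i)" for i
    using v w by (auto simp: W1inf_torus_def)
  define \<Psi> where "\<Psi> i = (\<lambda>(x, h). v i x - w i (x + h) - k * (norm h)\<^sup>2)" for i
  \<comment> \<open>At this distance the penalty equals \<open>2 * (V + W)\<close>, more than what
    can be gained by moving \<open>h\<close> away from 0.\<close>
  define \<rho> where "\<rho> = sqrt (2 * (V + W) / k)"
  have VW: "0 \<le> V + W" using V[of undefined 0] W[of undefined 0] by linarith
  have \<rho>: "0 \<le> \<rho>" "k * \<rho>\<^sup>2 = 2 * (V + W)" using VW k by (simp_all add: \<rho>_def)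
  have "\<exists>p\<in>cbox 0 1 \<times> cball 0 \<rho>. \<forall>q\<in>cbox 0 1 \<times> cball 0 \<rho>. \<Psi> i q \<le> \<Psi> i p" for i
  proof (rule continuous_attains_sup)
    show "compact (cbox 0 1 \<times> cball 0 \<rho> :: ((real ^ 'n) \<times> (real ^ 'n)) set)"
      by (intro compact_Times compact_cbox compact_cball)
    have "(0, 0) \<in> (cbox 0 1 \<times> cball 0 \<rho> :: ((real ^ 'n) \<times> (real ^ 'n)) set)"
      using \<rho>(1) by (simp add: mem_box_cart)
    then show "cbox 0 1 \<times> cball 0 \<rho> \<noteq> ({} :: ((real ^ 'n) \<times> (real ^ 'n)) set)" by blast
    show "continuous_on (cbox 0 1 \<times> cball 0 \<rho>) (\<Psi> i)"
      unfolding \<Psi>_def case_prod_unfold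
      by (intro continuous_intros continuous_on_compose2[OF vc[of UNIV]] continuous_on_compose2[OF wc[of UNIV]]) auto
  qed
  then obtain p where p: "\<And>i. p i \<in> cbox 0 1 \<times> cball 0 \<rho>"
    "\<And>i q. q \<in> cbox 0 1 \<times> cball 0 \<rho> \<Longrightarrow> \<Psi> i q \<le> \<Psi> i (p i)" by metis
  have global: "\<Psi> i (x, h) \<le> \<Psi> i (p i)" for i x h
  proof -
    obtain z where z: "\<forall>l. z $ l \<in> \<int>" "x + z \<in> cbox 0 1" by (rule torus_representative)
    have shift: "\<Psi> i (x, h') = \<Psi> i (x + z, h')" for h'
      using torus_funD[OF vp z(1)] torus_funD[OF wp z(1), of i "x + h'"]
      by (simp add: \<Psi>_def add.assoc add.commute[of z])
    show ?thesis
    proof (cases "norm h \<le> \<rho>")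
      case True
      then show ?thesis using p(2)[of "(x + z, h)" i] z(2) shift by simp
    next
      case False
      then have "k * \<rho>\<^sup>2 \<le> k * (norm h)\<^sup>2" using \<rho>(1) k by (simp add: power_mono)
      then have "\<Psi> i (x, h) \<le> \<Psi> i (x, 0)"
        using \<rho>(2) V[of i x] W[of i x] W[of i "x + h"] VW by (simp add: \<Psi>_def)
      also have "\<dots> \<le> \<Psi> i (p i)" using p(2)[of "(x + z, 0)" i] z(2) shift \<rho>(1) by simp
      finally show ?thesis .
    qed
  qed
  have "Max (range (\<lambda>i. \<Psi> i (p i))) \<in> range (\<lambda>i. \<Psi> i (p i))" by (intro Max_in) auto
  then obtain i where i: "Max (range (\<lambda>i. \<Psi> i (p i))) = \<Psi> i (p i)" by (rule rangeE)
  have max: "\<Psi> j (x, h) \<le> \<Psi> i (p i)" for j x h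
    using global[of j x h] Max_ge[of "range (\<lambda>i. \<Psi> i (p i))" "\<Psi> j (p j)"] i by simp
  obtain x h where xh: "p i = (x, h)" by fastforce
  show thesis
  proof
    show "x \<in> cbox 0 1" using p(1)[of i] xh by simp
    fix j x' y'
    show "v j x' - w j y' - k * (norm (x' - y'))\<^sup>2 \<le> v i x - w i (x + h) - k * (norm (x - (x + h)))\<^sup>2"
      using max[of j x' "y' - x'"] unfolding xh by (simp add: \<Psi>_def norm_minus_commute)
  qed
qed

text \<open>At a doubled maximum both tests have the same gradient \<open>p\<close>, bounded through
  the Lipschitz constant of \<open>v\<close>. Subtracting the two inequalities leaves only the
  variation of \<open>H\<close> and \<open>D\<close> between \<open>x\<close> and \<open>y\<close>,
  which vanishes as the penalty grows.\<close>

lemma ergodic_constant_le: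
  fixes H :: "'m::finite \<Rightarrow> real ^ 'n \<Rightarrow> real ^ 'n \<Rightarrow> real"
  assumes D: "\<And>i j. continuous_on UNIV (\<lambda>x. D x $ i $ j)"
    and mon: "\<And>x. monotone_matrix (D x)"
    and H: "\<And>i. continuous_on UNIV (\<lambda>(x, p). H i x p)"
    and v: "v \<in> W1inf_torus" and w: "w \<in> W1inf_torus"
    and sub: "visc_subsolution H D (\<chi> i. a) v" and super: "visc_supersolution H D (\<chi> i. b) w"
  shows "b \<le> a"
proof -
  obtain V L where V: "\<And>i x. \<bar>v i x\<bar> \<le> V"
    and L: "0 \<le> L" "\<And>i x y. \<bar>v i x - v i y\<bar> \<le> L * norm (x - y)"
    using W1inf_torus_bounds[OF v] by metis
  \<comment> \<open>The error in passing from \<open>x\<close> to \<open>y\<close>, summed over all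
    rows because the maximising index may change with the penalty.\<close>
  define f where "f x y p = (\<Sum>i\<in>UNIV. \<bar>H i y p - H i x p\<bar> + (\<Sum>j\<in>UNIV. \<bar>D y $ i $ j - D x $ i $ j\<bar> * V))" for x y p
  have "\<exists>x y p. x \<in> cbox 0 1 \<and> norm (x - y) \<le> L / k \<and> norm p \<le> 2 * L \<and> b - a \<le> f x y p"
    if k: "0 < k" for k
  proof -
    obtain i x y where x: "x \<in> cbox 0 1" and
      max: "\<And>j x' y'. v j x' - w j y' - k * (norm (x' - y'))\<^sup>2 \<le> v i x - w i y - k * (norm (x - y))\<^sup>2"
      using doubling_max[OF v w k] by metis
    define p where "p = (2 * k) *\<^sub>R (x - y)"
    \<comment> \<open>Compare the maximum with the diagonal pair \<open>(y, y)\<close>; the terms in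
      \<open>w\<close> cancel.\<close>
    have "k * (norm (x - y))\<^sup>2 \<le> v i x - v i y"
      using max[where j = i and x' = y and y' = y] by simp
    also have "\<dots> \<le> L * norm (x - y)" using L(2)[of i x y] by linarith
    finally have kL: "k * norm (x - y) \<le> L"
      using L(1) by (cases "x = y") (auto simp: power2_eq_square)
    have "local_max (\<lambda>z. v i z - k * (norm (z - y))\<^sup>2) x"
      unfolding local_max_def using max[where j = i and y' = y] by (simp add: algebra_simps)
    then have "H i x ((2 * k) *\<^sub>R (x - y)) + (\<Sum>j\<in>UNIV. D x $ i $ j * v j x) \<le> (\<chi> i. a) $ i"
      using sub C1_test_norm_square[of k y] unfolding visc_subsolution_def by blast
    then have le_a: "H i x p + (\<Sum>j\<in>UNIV. D x $ i $ j * v j x) \<le> a" by (simp add: p_def)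
    have "local_min (\<lambda>z. w i z - (- k) * (norm (z - x))\<^sup>2) y"
      unfolding local_min_def using max[where j = i and x' = x]
      by (simp add: norm_minus_commute algebra_simps)
    then have "(\<chi> i. b) $ i \<le> H i y ((2 * (- k)) *\<^sub>R (y - x)) + (\<Sum>j\<in>UNIV. D y $ i $ j * w j y)"
      using super C1_test_norm_square[of "- k" x] unfolding visc_supersolution_def by blast
    moreover have "(2 * (- k)) *\<^sub>R (y - x) = p" by (simp add: p_def algebra_simps)
    ultimately have le_b: "b \<le> H i y p + (\<Sum>j\<in>UNIV. D y $ i $ j * w j y)" by simp
    \<comment> \<open>Maximality over the index makes every difference nonpositive, and it is
      multiplied by a nonpositive off-diagonal entry; for \<open>j = i\<close> the difference is
      zero.\<close>
    have "0 \<le> (\<Sum>j\<in>UNIV. D y $ i $ j * ((v j x - w j y) - (v i x - w i y)))"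
    proof (rule sum_nonneg)
      fix j
      have "v j x - w j y \<le> v i x - w i y" using max[where x' = x and y' = y and j = j] by simp
      then show "0 \<le> D y $ i $ j * ((v j x - w j y) - (v i x - w i y))"
        using mon[of y] by (cases "j = i") (auto simp: monotone_matrix_def intro!: mult_nonpos_nonpos)
    qed
    then have "(\<Sum>j\<in>UNIV. D y $ i $ j * w j y) \<le> (\<Sum>j\<in>UNIV. D y $ i $ j * v j x)"
      unfolding monotone_sum_diff[OF mon, where z = "\<lambda>j. v j x - w j y"]
      by (simp add: right_diff_distrib sum_subtractf)
    then have "b - a \<le> H i y p - H i x p + (\<Sum>j\<in>UNIV. (D y $ i $ j - D x $ i $ j) * v j x)"
      using le_a le_b by (simp add: left_diff_distrib sum_subtractf)
    also have "\<dots> \<le> \<bar>H i y p - H i x p\<bar> + (\<Sum>j\<in>UNIV. \<bar>D y $ i $ j - D x $ i $ j\<bar> * V)"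
    proof (intro add_mono abs_ge_self sum_mono)
      fix j
      have "(D y $ i $ j - D x $ i $ j) * v j x \<le> \<bar>D y $ i $ j - D x $ i $ j\<bar> * \<bar>v j x\<bar>"
        by (metis abs_ge_self abs_mult)
      also have "\<dots> \<le> \<bar>D y $ i $ j - D x $ i $ j\<bar> * V" using V by (intro mult_left_mono) auto
      finally show "(D y $ i $ j - D x $ i $ j) * v j x \<le> \<bar>D y $ i $ j - D x $ i $ j\<bar> * V" .
    qed
    also have "\<dots> \<le> f x y p"
      unfolding f_def using V[of undefined x]
      by (intro member_le_sum[of i UNIV "\<lambda>i. \<bar>H i y p - H i x p\<bar> + (\<Sum>j\<in>UNIV. \<bar>D y $ i $ j - D x $ i $ j\<bar> * V)"])
        (auto intro!: add_nonneg_nonneg sum_nonneg)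
    finally have "b - a \<le> f x y p" .
    moreover have "norm p \<le> 2 * L" using kL k by (simp add: p_def)
    moreover have "norm (x - y) \<le> L / k" using kL k by (simp add: field_simps)
    ultimately show ?thesis using x by blast
  qed
  then have "\<exists>x y p. x \<in> cbox 0 1 \<and> norm (x - y) \<le> L / real (Suc n) \<and> norm p \<le> 2 * L \<and> b - a \<le> f x y p" for n
    by simp
  then obtain x y p where xyp: "\<And>n. x n \<in> cbox 0 1" "\<And>n. norm (x n - y n) \<le> L / real (Suc n)"
    "\<And>n. norm (p n) \<le> 2 * L" "\<And>n. b - a \<le> f (x n) (y n) (p n)" by metis
  \<comment> \<open>Only \<open>x\<close> and \<open>p\<close> need a convergent subsequence;
    \<open>y\<close> follows because \<open>x n - y n\<close> tends to 0.\<close>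
  have "seq_compact (cbox 0 1 \<times> cball 0 (2 * L) :: ((real ^ 'n) \<times> (real ^ 'n)) set)"
    unfolding compact_eq_seq_compact_metric[symmetric]
    by (intro compact_Times compact_cbox compact_cball)
  moreover have "\<forall>n. (x n, p n) \<in> cbox 0 1 \<times> cball 0 (2 * L)" using xyp by simp
  ultimately obtain q r where r: "strict_mono (r :: nat \<Rightarrow> nat)" "((\<lambda>n. (x n, p n)) \<circ> r) \<longlonglongrightarrow> q"
    by (rule seq_compactE)
  have x_lim: "(\<lambda>n. x (r n)) \<longlonglongrightarrow> fst q" and p_lim: "(\<lambda>n. p (r n)) \<longlonglongrightarrow> snd q"
    using tendsto_fst[OF r(2)] tendsto_snd[OF r(2)] by (simp_all add: o_def)
  have "(\<lambda>n. L / real (Suc n)) \<longlonglongrightarrow> 0"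
    using tendsto_mult_right_zero[OF LIMSEQ_inverse_real_of_nat, of L] by (simp add: divide_inverse)
  then have "(\<lambda>n. x n - y n) \<longlonglongrightarrow> 0"
    by (rule Lim_null_comparison[rotated]) (simp only: xyp(2) eventually_True)
  then have "(\<lambda>n. x (r n) - y (r n)) \<longlonglongrightarrow> 0"
    using LIMSEQ_subseq_LIMSEQ[OF _ r(1)] by (simp add: o_def)
  from tendsto_diff[OF x_lim this] have y_lim: "(\<lambda>n. y (r n)) \<longlonglongrightarrow> fst q" by simp
  have H_lim: "(\<lambda>n. H i (z n) (p (r n))) \<longlonglongrightarrow> H i (fst q) (snd q)" if "z \<longlonglongrightarrow> fst q" for z i
    using tendsto_compose_UNIV[OF H tendsto_Pair[OF that p_lim], of i] by (simp add: case_prod_unfold)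
  have "(\<lambda>n. f (x (r n)) (y (r n)) (p (r n))) \<longlonglongrightarrow>
      (\<Sum>i\<in>UNIV. \<bar>H i (fst q) (snd q) - H i (fst q) (snd q)\<bar>
        + (\<Sum>j\<in>UNIV. \<bar>D (fst q) $ i $ j - D (fst q) $ i $ j\<bar> * V))"
    unfolding f_def
    by (intro tendsto_intros H_lim[OF x_lim] H_lim[OF y_lim] tendsto_compose_UNIV[OF D x_lim] tendsto_compose_UNIV[OF D y_lim])
  then have "(\<lambda>n. f (x (r n)) (y (r n)) (p (r n))) \<longlonglongrightarrow> 0" by simp
  then have "b - a \<le> 0" using xyp(4) by (intro LIMSEQ_le_const) auto
  then show ?thesis by simp
qed

section \<open>The vanishing discount limit\<close>

text \<open>Arzela-Ascoli on the unit cube; periodicity makes the convergence uniform on the whole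
  space. The indices \<open>s n\<close> are chosen far enough along to give an explicit rate, and
  \<open>n \<le> s n\<close> replaces monotonicity.\<close>

lemma periodic_equilipschitz_subsequence:
  fixes v :: "nat \<Rightarrow> 'm::finite \<Rightarrow> real ^ 'n \<Rightarrow> real"
  assumes per: "\<And>n i. torus_fun (v n i)" and lip: "\<And>n i. R-lipschitz_on UNIV (v n i)"
    and bnd: "\<And>n i x. x \<in> cbox 0 1 \<Longrightarrow> \<bar>v n i x\<bar> \<le> B"
  obtains w s where "w \<in> W1inf_torus" "\<And>n. n \<le> s n"
    "\<And>n i x. \<bar>v (s n) i x - w i x\<bar> \<le> inverse (real (Suc n))"
proof -
  have R: "0 \<le> R" using lip lipschitz_on_nonneg by blast
  \<comment> \<open>Collecting the components in a vector gives one subsequence for all of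
    them.\<close>
  define F where "F n x = (\<chi> i. v n i x)" for n x
  have norm_F: "norm (F n x) \<le> real CARD('m) * B" if "x \<in> cbox 0 1" for n x
  proof -
    have "norm (F n x) \<le> (\<Sum>i\<in>UNIV. \<bar>v n i x\<bar>)"
      using norm_le_l1_cart[of "F n x"] by (simp add: F_def)
    also have "\<dots> \<le> (\<Sum>i\<in>(UNIV :: 'm set). B)" using bnd[OF that] by (intro sum_mono)
    finally show ?thesis by simp
  qed
  have lip_F: "norm (F n x - F n y) \<le> real CARD('m) * R * norm (x - y)" for n x y
  proof -
    have "norm (F n x - F n y) \<le> (\<Sum>i\<in>UNIV. \<bar>v n i x - v n i y\<bar>)"
      using norm_le_l1_cart[of "F n x - F n y"] by (simp add: F_def)
    also have "\<dots> \<le> (\<Sum>i\<in>(UNIV :: 'm set). R * norm (x - y))"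
      using lipschitz_onD[OF lip, of x y] by (intro sum_mono) (simp add: dist_norm)
    finally show ?thesis by simp
  qed
  have "\<exists>d>0. \<forall>n y. y \<in> cbox 0 1 \<and> norm (x - y) < d \<longrightarrow> norm (F n x - F n y) < e" if "0 < e" for x e
  proof (intro exI conjI allI impI)
    \<comment> \<open>The summand 1 keeps the equicontinuity radius defined when
      \<open>R = 0\<close>.\<close>
    have pos: "0 < real CARD('m) * R + 1" using R by (simp add: add_nonneg_pos)
    then show "0 < e / (real CARD('m) * R + 1)" using that by simp
    fix n y assume "y \<in> cbox 0 1 \<and> norm (x - y) < e / (real CARD('m) * R + 1)"
    then have "real CARD('m) * R * norm (x - y) + norm (x - y) < e" using pos by (simp add: field_simps)
    then show "norm (F n x - F n y) < e"
      using lip_F[of n x y] norm_ge_zero[of "x - y"] by linarith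
  qed
  then obtain g k where k: "strict_mono (k :: nat \<Rightarrow> nat)"
    and g: "\<And>e. 0 < e \<Longrightarrow> \<exists>N. \<forall>n x. N \<le> n \<and> x \<in> cbox 0 1 \<longrightarrow> norm (F (k n) x - g x) < e"
    using Arzela_Ascoli[of "cbox 0 1 :: (real ^ 'n) set" F "real CARD('m) * B"] norm_F compact_cbox by metis
  have "\<exists>z. (\<forall>l. z $ l \<in> \<int>) \<and> x + z \<in> cbox 0 1" for x :: "real ^ 'n"
    using torus_representative by metis
  then obtain z :: "real ^ 'n \<Rightarrow> real ^ 'n" where z: "\<And>x. \<forall>l. z x $ l \<in> \<int>" "\<And>x. x + z x \<in> cbox 0 1"
    by metis
  \<comment> \<open>\<open>g\<close> is controlled on the cube only. The choice of representative is
    harmless: \<open>w\<close> is the pointwise limit of periodic functions and hence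
    periodic.\<close>
  define w where "w i x = g (x + z x) $ i" for i x
  have "\<exists>m\<ge>n. \<forall>i x. \<bar>v m i x - w i x\<bar> \<le> inverse (real (Suc n))" for n
  proof -
    obtain N where N: "\<And>n' x. N \<le> n' \<Longrightarrow> x \<in> cbox 0 1 \<Longrightarrow> norm (F (k n') x - g x) < inverse (real (Suc n))"
      using g[of "inverse (real (Suc n))"] by auto
    define m where "m = max N n"
    have "\<bar>v (k m) i x - w i x\<bar> \<le> inverse (real (Suc n))" for i x
    proof -
      have "\<bar>v (k m) i x - w i x\<bar> = \<bar>(F (k m) (x + z x) - g (x + z x)) $ i\<bar>"
        using torus_funD[OF per z(1)] by (simp add: F_def w_def)
      also have "\<dots> \<le> norm (F (k m) (x + z x) - g (x + z x))" by (rule component_le_norm_cart)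
      also have "\<dots> \<le> inverse (real (Suc n))" using N[of m "x + z x"] z(2) by (simp add: m_def)
      finally show ?thesis .
    qed
    moreover have "n \<le> k m" using seq_suble[OF k, of m] by (simp add: m_def)
    ultimately show ?thesis by blast
  qed
  then obtain s where s: "\<And>n. n \<le> s n" "\<And>n i x. \<bar>v (s n) i x - w i x\<bar> \<le> inverse (real (Suc n))" by metis
  have lim: "(\<lambda>n. v (s n) i x) \<longlonglongrightarrow> w i x" for i x
  proof (rule LIM_zero_cancel, rule Lim_null_comparison[OF _ LIMSEQ_inverse_real_of_nat])
    show "\<forall>\<^sub>F n in sequentially. norm (v (s n) i x - w i x) \<le> inverse (real (Suc n))"
      using s(2) by simp
  qed
  have "torus_fun (w i)" for i
    unfolding torus_fun_def
  proof (intro allI impI)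
    fix x q :: "real ^ 'n" assume q: "\<forall>l. q $ l \<in> \<int>"
    show "w i (x + q) = w i x"
      using lim[of i "x + q"] lim[of i x] by (simp add: torus_funD[OF per q] LIMSEQ_unique)
  qed
  moreover have "R-lipschitz_on UNIV (w i)" for i
  proof (rule lipschitz_onI[OF _ R])
    fix x y
    have "(\<lambda>n. dist (v (s n) i x) (v (s n) i y)) \<longlonglongrightarrow> dist (w i x) (w i y)"
      by (intro tendsto_dist lim)
    then show "dist (w i x) (w i y) \<le> R * dist x y"
      using lipschitz_onD[OF lip] by (intro LIMSEQ_le_const2) auto
  qed
  ultimately have "w \<in> W1inf_torus" unfolding W1inf_torus_def by blast
  then show thesis using s that by blast
qed

text \<open>Normalised discounted solutions stay bounded on the cube, by the oscillation bound
  across components and the Lipschitz bound across points. Their right-hand sides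
  \<open>- l * a\<close> are bounded by \<open>M\<close>, and a limit of these is the
  constant.\<close>

lemma ergodic_solution_exists:
  fixes H :: "'m::finite \<Rightarrow> real ^ 'n \<Rightarrow> real ^ 'n \<Rightarrow> real"
    and D :: "real ^ 'n \<Rightarrow> real ^ 'm ^ 'm"
  assumes per: "\<And>i j. torus_fun (\<lambda>x. D x $ i $ j)"
    and cont: "\<And>i j. continuous_on UNIV (\<lambda>x. D x $ i $ j)"
    and mon: "\<And>x. monotone_matrix (D x)" and irr: "\<And>x. irreducible_matrix (D x)"
    and ham: "\<And>i. hamiltonian (H i)" and coer: "\<And>i. coercive (H i)"
  obtains a v where "v \<in> W1inf_torus" "visc_solution H D (\<chi> i. a) v"
proof -
  have contH: "continuous_on UNIV (\<lambda>(x, p). H i x p)" for i using ham by (simp add: hamiltonian_def)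
  obtain R K M where MRK: "\<forall>l>0. \<exists>u. visc_solution H (\<lambda>x. D x + l *\<^sub>R mat 1) 0 u \<and> (\<forall>i. torus_fun (u i)) \<and>
      (\<forall>i. R-lipschitz_on UNIV (u i)) \<and> (\<forall>i j x. u i x - u j x \<le> K) \<and> (\<forall>i x. \<bar>l * u i x\<bar> \<le> M)"
    by (rule discounted_solutions[where H = H and D = D, OF per cont mon irr ham coer])
  define l where "l n = inverse (real (Suc n))" for n
  have l: "0 < l n" for n by (simp add: l_def)
  have ex_u: "\<forall>n. \<exists>u. visc_solution H (\<lambda>x. D x + l n *\<^sub>R mat 1) 0 u \<and> (\<forall>i. torus_fun (u i)) \<and>
      (\<forall>i. R-lipschitz_on UNIV (u i)) \<and> (\<forall>i j x. u i x - u j x \<le> K) \<and> (\<forall>i x. \<bar>l n * u i x\<bar> \<le> M)"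
    using MRK l by simp
  obtain u where sol: "\<And>n. visc_solution H (\<lambda>x. D x + l n *\<^sub>R mat 1) 0 (u n)"
    and u_per: "\<And>n i. torus_fun (u n i)" and u_lip: "\<And>n i. R-lipschitz_on UNIV (u n i)"
    and u_osc: "\<And>n i j x. u n i x - u n j x \<le> K" and u_bnd: "\<And>n i x. \<bar>l n * u n i x\<bar> \<le> M"
    using choice[OF ex_u] by blast
  \<comment> \<open>The value of one arbitrary component, with index \<open>undefined\<close>, at
    the origin.\<close>
  define a where "a n = u n undefined 0" for n
  have "bounded (range (\<lambda>n. - l n * a n))"
    unfolding bounded_iff a_def using u_bnd by auto
  then obtain c r where r: "strict_mono (r :: nat \<Rightarrow> nat)" "((\<lambda>n. - l n * a n) \<circ> r) \<longlonglongrightarrow> c"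
    using bounded_imp_convergent_subsequence by metis
  define v where "v n i x = u (r n) i x - a (r n)" for n i x
  have v_sol: "visc_solution H (\<lambda>x. D x + l (r n) *\<^sub>R mat 1) (\<chi> i. - l (r n) * a (r n)) (v n)" for n
  proof -
    have sum: "(\<Sum>j\<in>UNIV. (D x + l (r n) *\<^sub>R mat 1) $ i $ j) = l (r n)" for x i
      using discount_sum[of "D x" "l (r n)" i "\<lambda>_. 1"] mon[of x] by (simp add: monotone_matrix_def)
    from visc_solution_shift[OF this sol, of "a (r n)"] show ?thesis
      unfolding v_def by simp
  qed
  have v_lip: "R-lipschitz_on UNIV (v n i)" for n i
    using u_lip[of "r n" i] unfolding v_def lipschitz_on_def by (simp add: dist_real_def)
  have v_per: "torus_fun (v n i)" for n i
    using u_per[of "r n" i] by (simp add: v_def torus_fun_def)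
  have R: "0 \<le> R" using u_lip lipschitz_on_nonneg by blast
  obtain b where b: "\<And>x :: real ^ 'n. x \<in> cbox 0 1 \<Longrightarrow> norm x \<le> b"
    using bounded_cbox[of "0 :: real ^ 'n" 1] unfolding bounded_iff by blast
  have v_bnd: "\<bar>v n i x\<bar> \<le> K + R * b" if "x \<in> cbox 0 1" for n i x
  proof -
    have "\<bar>u (r n) i x - u (r n) undefined x\<bar> \<le> K"
      using u_osc[of "r n" i x undefined] u_osc[of "r n" undefined x i] by (simp add: abs_le_iff)
    moreover have "\<bar>u (r n) undefined x - a (r n)\<bar> \<le> R * norm x"
      using lipschitz_onD[OF u_lip, of x 0 "r n" undefined] by (simp add: a_def dist_norm)
    moreover have "R * norm x \<le> R * b" using b[OF that] R by (rule mult_left_mono)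
    ultimately show ?thesis unfolding v_def by linarith
  qed
  obtain w s where w: "w \<in> W1inf_torus" and s: "\<And>n. n \<le> s n"
    and vw: "\<And>n i x. \<bar>v (s n) i x - w i x\<bar> \<le> inverse (real (Suc n))"
  proof (rule periodic_equilipschitz_subsequence[where v = v and R = R and B = "K + R * b"])
    show "\<bar>v n i x\<bar> \<le> K + R * b" if "x \<in> cbox 0 1" for n i x using that by (rule v_bnd)
  qed (rule v_per v_lip | rule that; assumption)+
  have "filterlim s at_top sequentially"
    by (rule filterlim_at_top_mono[OF filterlim_ident]) (simp add: s)
  then have c_lim: "(\<lambda>n. - l (r (s n)) * a (r (s n))) \<longlonglongrightarrow> c"
    using filterlim_compose[OF r(2)] by (simp add: o_def)
  have "visc_solution H D (\<chi> i. c) w"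
  \<comment> \<open>One rate \<open>e\<close> serves twice: it bounds the remaining discount,
    through \<open>n \<le> r (s n)\<close>, and the distance to the limit.\<close>
  proof (rule visc_solution_uniform_limit[where e = "\<lambda>n. inverse (real (Suc n))" and w = "\<lambda>n. v (s n)"
        and E = "\<lambda>n x. D x + l (r (s n)) *\<^sub>R mat 1" and b = "\<lambda>n. \<chi> i. - l (r (s n)) * a (r (s n))"])
    show "(D y + l (r (s n)) *\<^sub>R mat 1) $ i $ j \<le> 0" if "j \<noteq> i" for n y i j
      using mon[of y] that unfolding discount_nth by (simp add: monotone_matrix_def)
    show "\<bar>(D y + l (r (s n)) *\<^sub>R mat 1) $ i $ j - D y $ i $ j\<bar> \<le> inverse (real (Suc n))" for n y i j
    proof -
      have "n \<le> r (s n)" using s[of n] seq_suble[OF r(1), of "s n"] by linarith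
      then have "l (r (s n)) \<le> inverse (real (Suc n))" unfolding l_def by (intro le_imp_inverse_le) auto
      then show ?thesis unfolding discount_nth using l[of "r (s n)"] by simp
    qed
    show "(\<lambda>n. \<chi> i. - l (r (s n)) * a (r (s n))) \<longlonglongrightarrow> (\<chi> i. c)"
      by (rule vec_tendstoI) (simp add: c_lim[simplified])
    show "continuous_on UNIV (w j)" for j
      using w by (auto simp: W1inf_torus_def intro: lipschitz_on_continuous_on)
  qed (rule contH cont v_sol vw LIMSEQ_inverse_real_of_nat)+
  then show thesis using w that by blast
qed

section \<open>Existence, the kernel and uniqueness of the constant combined\<close>

theorem theorem2p2:
  fixes H :: "'m::finite \<Rightarrow> real ^ 'n \<Rightarrow> real ^ 'n \<Rightarrow> real"
    and D :: "real ^ 'n \<Rightarrow> real ^ 'm ^ 'm"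
  assumes "\<And>i j. torus_fun (\<lambda>x. D x $ i $ j)"
    and "\<And>i j. continuous_on UNIV (\<lambda>x. D x $ i $ j)"
    and "\<And>x. monotone_matrix (D x)"
    and "\<And>x. irreducible_matrix (D x)"
    and "\<And>i. hamiltonian (H i)"
    and "\<And>i. coercive (H i)"
  shows "\<exists>c1 :: real.
     (\<exists>v \<in> W1inf_torus. visc_solution H D (\<chi> i. c1) v) \<and>
     (\<forall>x. (\<chi> i. c1) \<in> matrix_ker (D x)) \<and>
     (\<forall>c :: real ^ 'm.
        (\<forall>x. c \<in> matrix_ker (D x)) \<and> (\<exists>v \<in> W1inf_torus. visc_solution H D c v) \<longrightarrow>
        c = (\<chi> i. c1))"
proof -
  have H: "continuous_on UNIV (\<lambda>(x, p). H i x p)" for i using assms(5) by (simp add: hamiltonian_def)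
  obtain a v where v: "v \<in> W1inf_torus" "visc_solution H D (\<chi> i. a) v"
    
    by (rule ergodic_solution_exists[where H = H and D = D, OF assms])
  have ker: "matrix_ker (D x) = range (\<lambda>b. \<chi> i. b)" for x
    by (rule matrix_ker_monotone_irreducible[OF assms(3,4)])
  \<comment> \<open>The kernel at the point 0 consists of constant vectors, so \<open>c\<close> has
    a single entry \<open>b\<close>. Comparing \<open>v\<close> and \<open>w\<close> in both roles
    gives the two inequalities between \<open>a\<close> and \<open>b\<close>.\<close>
  have "c = (\<chi> i. a)" if c: "c \<in> matrix_ker (D 0)" and w: "w \<in> W1inf_torus" "visc_solution H D c w" for c w
  proof -
    obtain b where b: "c = (\<chi> i. b)" using c unfolding ker by blast
    have sol: "visc_subsolution H D (\<chi> i. a) v" "visc_supersolution H D (\<chi> i. a) v"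
      "visc_subsolution H D (\<chi> i. b) w" "visc_supersolution H D (\<chi> i. b) w"
      using v(2) w(2) by (simp_all add: visc_solution_def b)
    have "b \<le> a" by (rule ergodic_constant_le[OF assms(2,3) H v(1) w(1) sol(1,4)])
    moreover have "a \<le> b" by (rule ergodic_constant_le[OF assms(2,3) H w(1) v(1) sol(3,2)])
    ultimately show ?thesis by (simp add: b)
  qed
  then show ?thesis using v ker by blast
qed

end
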